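(* Let $\Omega$ be a Hausdorff space with Borel $\sigma$-field $\mathfrak{B}$, let $\Theta$ be the set of all measures $\mu$ on $(\Omega,\mathfrak{B})$ with $\mu(\Omega)<\infty$, equipped with the $\tau$-topology, and let $\Theta_0,\Theta_1\subset\Theta$. Let $\kappa_1,\ldots,\kappa_n$ be $n$ independent realizations of a Poisson random process (Poisson random measure) on $\Omega$ with mean measure $\mu\in\Theta$, and consider testing $H_0:\mu\in\Theta_0$ versus $H_1:\mu\in\Theta_1$. Write $\mathrm{cl}_\tau$ for closure in the $\tau$-topology. Then: (i) If $\Theta_0$ and $\Theta_1$ are both relatively compact in the $\tau$-topology and $\mathrm{cl}_\tau(\Theta_0)\cap\mathrm{cl}_\tau(\Theta_1)\ne\emptyset$, then $H_0$ and $H_1$ are indistinguishable. (ii) If $\Theta_0$ or $\Theta_1$ is relatively compact in the $\tau$-topology and $\mathrm{cl}_\tau(\Theta_0)\cap\mathrm{cl}_\tau(\Theta_1)=\emptyset$, then $H_0$ and $H_1$ are distinguishable. Moreover, there exist a sequence of tests $K_n=K_n(\kappa_1,\ldots,\kappa_n)$, a constant $c>0$ and a constant $n_0$ such that for all $n>n_0$ $$\alpha(K_n)\le\exp\{-cn\}\quad\text{and}\quad\beta(K_n)\le\exp\{-cn\}.$$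
   Context: The $\tau$-topology on $\Theta$ is the coarsest topology for which all maps $\mu\mapsto\mu(B)$, $B\in\mathfrak{B}$, are continuous. A set is relatively compact in the $\tau$-topology if its $\tau$-closure in $\Theta$ is $\tau$-compact. A test is a measurable function $K_n=K_n(\kappa_1,\ldots,\kappa_n)$ with values in $[0,1]$ (the probability of rejecting $H_0$). Its error probabilities are $\alpha(K_n)=\sup_{\mu\in\Theta_0}E_\mu[K_n]$ and $\beta(K_n)=\sup_{\mu\in\Theta_1}E_\mu[1-K_n]$, where $E_\mu$ is expectation when $\kappa_1,\ldots,\kappa_n$ are independent Poisson processes with mean measure $\mu$. $H_0$ and $H_1$ are distinguishable if for every $0<\alpha<1$ there are tests $K_n$, $n=1,2,\ldots$, with $\alpha(K_n)<\alpha$ and $\lim_{n\to\infty}\beta(K_n)=0$. They are indistinguishable if $\alpha(K_n)+\beta(K_n)\ge1$ for every $n$ and every test $K_n$. *)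

theory Defs
  imports "HOL-Probability.Probability"
begin

definition finite_measures :: "'a::t2_space measure set" where
  "finite_measures = {\<mu>. sets \<mu> = sets borel \<and> finite_measure \<mu>}"

definition tau_topology :: "'a::t2_space measure topology" where
  "tau_topology = topology_generated_by
     {{\<mu> \<in> finite_measures. measure \<mu> B \<in> U} | B U. B \<in> sets borel \<and> open U}"

lemma topspace_tau_topology: "topspace tau_topology = finite_measures"
  unfolding tau_topology_def topology_generated_by_topspace
proof (rule set_eqI, rule iffI)
  fix \<mu> :: "'a measure"
  assume "\<mu> \<in> finite_measures"
  then have "\<mu> \<in> {\<mu> \<in> finite_measures. measure \<mu> {} \<in> UNIV}" by simp
  then show "\<mu> \<in> \<Union> {{\<mu> \<in> finite_measures. measure \<mu> B \<in> U} | B U. B \<in> sets borel \<and> open U}"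
    using sets.empty_sets open_UNIV by blast
qed auto

lemma continuous_map_tau_topology:
  assumes "B \<in> sets borel"
  shows "continuous_map tau_topology euclideanreal (\<lambda>\<mu>. measure \<mu> B)"
proof -
  have "openin tau_topology {\<mu> \<in> finite_measures. measure \<mu> B \<in> U}" if "open U" for U
    unfolding tau_topology_def using assms that
    by (intro topology_generated_by_Basis) blast
  then show ?thesis
    by (simp add: continuous_map_def topspace_tau_topology)
qed

lemma tau_topology_coarsest:
  assumes "topspace T = finite_measures"
    and "\<And>B. B \<in> sets borel \<Longrightarrow> continuous_map T euclideanreal (\<lambda>\<mu>. measure \<mu> B)"
    and "openin tau_topology V"
  shows "openin T V"
proof -
  have "openin T W"
    if "W \<in> {{\<mu> \<in> finite_measures. measure \<mu> B \<in> U} | B U. B \<in> sets borel \<and> open U}" for W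
    using that assms(1,2) by (auto simp: continuous_map_def)
  moreover have "generate_topology_on
      {{\<mu> \<in> finite_measures. measure \<mu> B \<in> U} | B U. B \<in> sets borel \<and> open U} V"
    using assms(3) unfolding tau_topology_def openin_topology_generated_by_iff .
  ultimately show ?thesis
    using generate_topology_on_coarsest istopology_openin by blast
qed

definition tau_relatively_compact :: "'a::t2_space measure set \<Rightarrow> bool" where
  "tau_relatively_compact S \<longleftrightarrow> compactin tau_topology (tau_topology closure_of S)"

text \<open>A realization of a Poisson process with finite mean measure is a finite integer-valued
  Borel measure, whose value at \<open>B\<close> is the number of points in \<open>B\<close>. The space of these measures
  carries the sigma-algebra generated by the counts.\<close>

definition configurations :: "'a::t2_space measure set" where
  "configurations = {\<kappa> \<in> finite_measures. \<forall>B \<in> sets borel. measure \<kappa> B \<in> \<nat>}"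

definition configuration_space :: "'a::t2_space measure measure" where
  "configuration_space = sigma configurations
     {{\<kappa> \<in> configurations. measure \<kappa> B \<in> A} | A B. A \<in> sets borel \<and> B \<in> sets borel}"

definition poisson_process :: "'w measure \<Rightarrow> ('w \<Rightarrow> 'a::t2_space measure) \<Rightarrow> 'a measure \<Rightarrow> bool" where
  "poisson_process P \<kappa> \<mu> \<longleftrightarrow>
     prob_space P \<and>
     \<kappa> \<in> measurable P configuration_space \<and>
     (\<forall>B \<in> sets borel. \<forall>k::nat.
        measure P {\<omega> \<in> space P. measure (\<kappa> \<omega>) B = real k} =
          measure \<mu> B ^ k / fact k * exp (- measure \<mu> B)) \<and>
     (\<forall>(I::nat set) B. finite I \<longrightarrow> B ` I \<subseteq> sets borel \<longrightarrow> disjoint_family_on B I \<longrightarrow>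
        prob_space.indep_vars P (\<lambda>_. borel) (\<lambda>i \<omega>. measure (\<kappa> \<omega>) (B i)) I)"

text \<open>The counts on the members of any finite family of Borel sets are sums of counts on disjoint
  ones, so the two conditions on the counts determine the law on \<open>configuration_space\<close>. It exists
  for every finite \<open>\<mu>\<close>, as the law of a Poisson number of i.i.d. points.\<close>

definition poisson_law :: "'a::t2_space measure \<Rightarrow> 'a measure measure" where
  "poisson_law \<mu> =
     (THE P. sets P = sets configuration_space \<and> poisson_process P (\<lambda>\<kappa>. \<kappa>) \<mu>)"

definition expectation_under ::
    "nat \<Rightarrow> 'a::t2_space measure \<Rightarrow> ((nat \<Rightarrow> 'a measure) \<Rightarrow> real) \<Rightarrow> real" where
  "expectation_under n \<mu> f = integral\<^sup>L (PiM {1..n} (\<lambda>_. poisson_law \<mu>)) f"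

definition is_test :: "nat \<Rightarrow> ((nat \<Rightarrow> 'a::t2_space measure) \<Rightarrow> real) \<Rightarrow> bool" where
  "is_test n K \<longleftrightarrow>
     K \<in> borel_measurable (PiM {1..n} (\<lambda>_. configuration_space)) \<and>
     (\<forall>\<kappa> \<in> space (PiM {1..n} (\<lambda>_. configuration_space)). 0 \<le> K \<kappa> \<and> K \<kappa> \<le> 1)"

text \<open>The suprema are taken in \<^typ>\<open>ennreal\<close>, so that a supremum over an empty hypothesis is 0.\<close>

definition alpha_error ::
    "'a::t2_space measure set \<Rightarrow> nat \<Rightarrow> ((nat \<Rightarrow> 'a measure) \<Rightarrow> real) \<Rightarrow> ennreal" where
  "alpha_error \<Theta>0 n K = (SUP \<mu>\<in>\<Theta>0. ennreal (expectation_under n \<mu> K))"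

definition beta_error ::
    "'a::t2_space measure set \<Rightarrow> nat \<Rightarrow> ((nat \<Rightarrow> 'a measure) \<Rightarrow> real) \<Rightarrow> ennreal" where
  "beta_error \<Theta>1 n K = (SUP \<mu>\<in>\<Theta>1. ennreal (expectation_under n \<mu> (\<lambda>\<kappa>. 1 - K \<kappa>)))"

definition distinguishable :: "'a::t2_space measure set \<Rightarrow> 'a measure set \<Rightarrow> bool" where
  "distinguishable \<Theta>0 \<Theta>1 \<longleftrightarrow>
     (\<forall>a::real. 0 < a \<longrightarrow> a < 1 \<longrightarrow>
        (\<exists>K. (\<forall>n\<ge>1. is_test n (K n) \<and> alpha_error \<Theta>0 n (K n) < ennreal a) \<and>
             (\<lambda>n. beta_error \<Theta>1 n (K n)) \<longlonglongrightarrow> 0))"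

definition indistinguishable :: "'a::t2_space measure set \<Rightarrow> 'a measure set \<Rightarrow> bool" where
  "indistinguishable \<Theta>0 \<Theta>1 \<longleftrightarrow>
     (\<forall>n\<ge>1. \<forall>K. is_test n K \<longrightarrow> alpha_error \<Theta>0 n K + beta_error \<Theta>1 n K \<ge> 1)"

end

theory Submission
  imports Defs
begin

text \<open>
Both halves rest on an explicit form of the law of the process: given that it has \<open>m\<close> points, a
Poisson process with mean measure \<open>\<mu>\<close> is the counting measure of \<open>m\<close> independent draws, so an event
\<open>A\<close> has probability \<open>\<Sum>m. exp (- \<mu> UNIV) / m! * \<mu>\<^sup>m (T\<^sub>m\<^sup>-\<^sup>1 A)\<close>, where \<open>T\<^sub>m\<close> turns \<open>m\<close> points into their
counting measure (\<open>poisson_law_eq\<close>).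

Indistinguishability. Let \<open>\<nu>\<close> lie in both closures and let \<open>K\<close> be a test. \<open>K\<close> depends on the counts of
only countably many Borel sets (\<open>statistic_countably_determined\<close>); let \<open>N\<close> be the sigma-algebra they
generate. On a countable \<open>\<pi>\<close>-system generating \<open>N\<close> the point \<open>\<nu>\<close> is the limit of a sequence from
each hypothesis, and \<open>\<tau>\<close>-compactness of the closure promotes this to convergence on every member of
\<open>N\<close> (\<open>closure_point_sequential_limit\<close>). Setwise convergence along a sequence passes to integrals of
uniformly bounded, pointwise convergent integrands, by a version of Fatou's lemma with varying
measures (\<open>integral_tendsto_setwise\<close>). It then passes to finite products by Fubini, hence through
the series to Poisson laws and finally to \<open>E\<^sub>\<mu> K\<close> (\<open>expectation_under_tendsto\<close>). Along the two
sequences \<open>E K + E (1 - K)\<close> tends to \<open>E\<^sub>\<nu> K + E\<^sub>\<nu> (1 - K) = 1\<close>. Sequences are essential here: Fatou's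
lemma is false for nets, which is why \<open>N\<close> must be countably generated.

Distinguishability. Call two sets of mean measures exponentially separable if some tests have both
errors at most \<open>exp (- c n)\<close> eventually. This relation is symmetric and stable under finite unions:
a null hypothesis that is a union is tested by the product of the tests (\<open>exp_separable_Un_left\<close>). Chernoff bounds for the number of
points in one Borel set separate \<open>\<mu> B \<le> a\<close> from \<open>\<mu> B \<ge> b\<close> whenever \<open>a < b\<close>, uniformly even when
\<open>\<mu> B\<close> is unbounded (\<open>exp_separable_count\<close>). Hence a basic \<open>\<tau>\<close>-neighbourhood of radius \<open>\<epsilon> / 2\<close> is
separable from the complement of the one of radius \<open>\<epsilon>\<close>, and finitely many of these neighbourhoods
cover the compact closure while the larger ones avoid the other hypothesis
(\<open>exp_separable_of_compact\<close>).
\<close>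

section \<open>Setwise convergence of finite measures\<close>

definition setwise_tendsto :: "(nat \<Rightarrow> 'b measure) \<Rightarrow> 'b measure \<Rightarrow> bool" where
  "setwise_tendsto M L \<longleftrightarrow>
     finite_measure L \<and> (\<forall>k. finite_measure (M k) \<and> sets (M k) = sets L) \<and>
     (\<forall>A\<in>sets L. (\<lambda>k. measure (M k) A) \<longlonglongrightarrow> measure L A)"

lemma setwise_tendsto_emeasure:
  assumes "setwise_tendsto M L" "A \<in> sets L"
  shows "(\<lambda>k. emeasure (M k) A) \<longlonglongrightarrow> emeasure L A"
proof -
  have fin: "finite_measure (M k)" "finite_measure L" for k
    using assms(1) by (auto simp: setwise_tendsto_def)
  have "(\<lambda>k. ennreal (measure (M k) A)) \<longlonglongrightarrow> ennreal (measure L A)"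
    using assms by (intro tendsto_ennrealI) (auto simp: setwise_tendsto_def)
  then show ?thesis
    using fin by (simp add: finite_measure.emeasure_eq_measure)
qed

text \<open>Integrals of simple functions converge, and the integral of \<open>f\<close> is the supremum of those
  below it; only the lower estimate survives the supremum. The simple functions are taken with finite
  values, since multiplication by \<open>\<infinity>\<close> is not continuous at 0.\<close>
lemma nn_integral_le_liminf_setwise:
  fixes f :: "'b \<Rightarrow> ennreal"
  assumes conv: "setwise_tendsto M L"
  shows "(\<integral>\<^sup>+x. f x \<partial>L) \<le> liminf (\<lambda>k. \<integral>\<^sup>+x. f x \<partial>M k)"
  unfolding nn_integral_def_finite[of L]
proof (rule SUP_least)
  fix g assume "g \<in> {g. simple_function L g \<and> g \<le> f \<and> (\<forall>x. g x < top)}"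
  then have g: "simple_function L g" "g \<le> f" "\<And>x. g x < top" by auto
  have [simp]: "sets (M k) = sets L" for k using conv by (auto simp: setwise_tendsto_def)
  then have [simp]: "space (M k) = space L" for k by (rule sets_eq_imp_space_eq)
  have gM: "simple_function (M k) g" for k
    using g(1) by (auto simp: simple_function_def)
  have "(\<lambda>k. integral\<^sup>S (M k) g) \<longlonglongrightarrow> integral\<^sup>S L g"
    unfolding simple_integral_def
  proof (simp, rule tendsto_sum)
    fix y assume "y \<in> g ` space L"
    then have "y < top" using g(3) by auto
    moreover have "g -` {y} \<inter> space L \<in> sets L"
      using g(1) \<open>y \<in> g ` space L\<close> by (auto simp: simple_function_def)
    ultimately show "(\<lambda>k. y * emeasure (M k) (g -` {y} \<inter> space L)) \<longlonglongrightarrow> y * emeasure L (g -` {y} \<inter> space L)"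
      by (intro ennreal_tendsto_cmult setwise_tendsto_emeasure[OF conv])
  qed
  then have "integral\<^sup>S L g = liminf (\<lambda>k. integral\<^sup>S (M k) g)"
    by (simp add: lim_imp_Liminf)
  also have "\<dots> \<le> liminf (\<lambda>k. \<integral>\<^sup>+x. f x \<partial>M k)"
  proof (intro Liminf_mono always_eventually allI)
    fix k
    have "integral\<^sup>S (M k) g = integral\<^sup>N (M k) g"
      using gM by (simp add: nn_integral_eq_simple_integral)
    also have "\<dots> \<le> integral\<^sup>N (M k) f"
      using g(2) by (intro nn_integral_mono) (auto simp: le_fun_def)
    finally show "integral\<^sup>S (M k) g \<le> (\<integral>\<^sup>+x. f x \<partial>M k)" .
  qed
  finally show "integral\<^sup>S L g \<le> liminf (\<lambda>k. \<integral>\<^sup>+x. f x \<partial>M k)" .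
qed

text \<open>Fatou's lemma with both the integrands and the measures varying: the lower bound for a fixed
  function applies to each tail infimum \<open>INF k\<ge>N. f k\<close>, and these increase to the limit inferior.\<close>
lemma fatou_setwise:
  fixes f :: "nat \<Rightarrow> 'b \<Rightarrow> ennreal"
  assumes conv: "setwise_tendsto M L" and [measurable]: "\<And>k. f k \<in> borel_measurable L"
  shows "(\<integral>\<^sup>+x. liminf (\<lambda>k. f k x) \<partial>L) \<le> liminf (\<lambda>k. \<integral>\<^sup>+x. f k x \<partial>M k)"
proof -
  have "(\<integral>\<^sup>+x. liminf (\<lambda>k. f k x) \<partial>L) = (SUP N. \<integral>\<^sup>+x. (INF k\<in>{N..}. f k x) \<partial>L)"
    unfolding liminf_SUP_INF
    by (intro nn_integral_monotone_convergence_SUP)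
       (auto simp: incseq_def le_fun_def intro!: INF_superset_mono)
  also have "\<dots> \<le> liminf (\<lambda>k. \<integral>\<^sup>+x. f k x \<partial>M k)"
  proof (rule SUP_least)
    fix N
    have "(\<integral>\<^sup>+x. (INF k\<in>{N..}. f k x) \<partial>L) \<le> liminf (\<lambda>k. \<integral>\<^sup>+x. (INF k\<in>{N..}. f k x) \<partial>M k)"
      by (rule nn_integral_le_liminf_setwise[OF conv])
    also have "\<dots> \<le> liminf (\<lambda>k. \<integral>\<^sup>+x. f k x \<partial>M k)"
      by (intro Liminf_mono eventually_sequentiallyI[of N] nn_integral_mono INF_lower) auto
    finally show "(\<integral>\<^sup>+x. (INF k\<in>{N..}. f k x) \<partial>L) \<le> \<dots>" .
  qed
  finally show ?thesis .
qed

text \<open>Fatou's lemma for \<open>f k\<close> bounds the integrals from below and Fatou's lemma for \<open>1 - f k\<close> bounds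
  them from above, because the total masses converge.\<close>
lemma integral_tendsto_setwise:
  fixes f :: "nat \<Rightarrow> 'b \<Rightarrow> real"
  assumes conv: "setwise_tendsto M L"
    and fm[measurable]: "\<And>k. f k \<in> borel_measurable L" and gm[measurable]: "g \<in> borel_measurable L"
    and lim: "\<And>x. x \<in> space L \<Longrightarrow> (\<lambda>k. f k x) \<longlonglongrightarrow> g x"
    and bnd: "\<And>k x. x \<in> space L \<Longrightarrow> f k x \<in> {0..1}"
  shows "(\<lambda>k. \<integral>x. f k x \<partial>M k) \<longlonglongrightarrow> (\<integral>x. g x \<partial>L)"
proof -
  have [simp]: "sets (M k) = sets L" for k using conv by (auto simp: setwise_tendsto_def)
  then have [simp]: "space (M k) = space L" for k by (rule sets_eq_imp_space_eq)
  have finM: "finite_measure (M k)" for k using conv by (auto simp: setwise_tendsto_def)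
  have finL: "finite_measure L" using conv by (auto simp: setwise_tendsto_def)
  have gb: "g x \<in> {0..1}" if "x \<in> space L" for x
    by (rule closed_sequentially[OF _ _ lim[OF that]]) (use bnd that in auto)
  have lower: "ennreal (\<integral>x. v x \<partial>L) \<le> liminf (\<lambda>k. ennreal (\<integral>x. u k x \<partial>M k))"
    if um[measurable]: "\<And>k. u k \<in> borel_measurable L" and vm[measurable]: "v \<in> borel_measurable L"
      and ul: "\<And>x. x \<in> space L \<Longrightarrow> (\<lambda>k. u k x) \<longlonglongrightarrow> v x"
      and ub: "\<And>k x. x \<in> space L \<Longrightarrow> u k x \<in> {0..1}"
      and vb: "\<And>x. x \<in> space L \<Longrightarrow> v x \<in> {0..1}" for u :: "nat \<Rightarrow> 'b \<Rightarrow> real" and v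
  proof -
    have iu: "integrable (M k) (u k)" for k
      using ub um[of k] by (intro finite_measure.integrable_const_bound[OF finM, of _ 1] AE_I2) 
        (auto simp: measurable_def)
    have iv: "integrable L v"
      using vb by (intro finite_measure.integrable_const_bound[OF finL, of _ 1] AE_I2) auto
    have "ennreal (\<integral>x. v x \<partial>L) = (\<integral>\<^sup>+x. ennreal (v x) \<partial>L)"
      using vb by (intro nn_integral_eq_integral[symmetric] iv AE_I2) auto
    also have "\<dots> = (\<integral>\<^sup>+x. liminf (\<lambda>k. ennreal (u k x)) \<partial>L)"
      using ul by (intro nn_integral_cong lim_imp_Liminf[symmetric] tendsto_ennrealI) auto
    also have "\<dots> \<le> liminf (\<lambda>k. \<integral>\<^sup>+x. ennreal (u k x) \<partial>M k)"
      by (rule fatou_setwise[OF conv]) measurable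
    also have "(\<lambda>k. \<integral>\<^sup>+x. ennreal (u k x) \<partial>M k) = (\<lambda>k. ennreal (\<integral>x. u k x \<partial>M k))"
      using ub by (intro ext nn_integral_eq_integral iu AE_I2) auto
    finally show ?thesis .
  qed
  define c where "c k = measure (M k) (space L)" for k
  define d where "d = measure L (space L)"
  have cd: "c \<longlonglongrightarrow> d" using conv unfolding c_def[abs_def] d_def by (simp add: setwise_tendsto_def)
  define a where "a k = (\<integral>x. f k x \<partial>M k)" for k
  define b where "b = (\<integral>x. g x \<partial>L)"
  have i_f: "integrable (M k) (f k)" for k
    using bnd fm[of k] by (intro finite_measure.integrable_const_bound[OF finM, of _ 1] AE_I2) 
        (auto simp: measurable_def)
  have i_g: "integrable L g"
      using gb by (intro finite_measure.integrable_const_bound[OF finL, of _ 1] AE_I2) auto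
  have a0: "0 \<le> a k" for k unfolding a_def using bnd by (intro integral_nonneg_AE AE_I2) auto
  have a1: "(\<integral>x. 1 - f k x \<partial>M k) = c k - a k" for k
    using finite_measure.integrable_const[OF finM] i_f by (subst Bochner_Integration.integral_diff) (auto simp: c_def a_def)
  have b1: "(\<integral>x. 1 - g x \<partial>L) = d - b"
    using finite_measure.integrable_const[OF finL] i_g by (subst Bochner_Integration.integral_diff) (auto simp: d_def b_def)
  have ac: "a k \<le> c k" for k 
    using a1[of k] bnd by (subst diff_ge_0_iff_ge[symmetric], subst a1[symmetric], intro integral_nonneg_AE AE_I2) auto
  have b0: "0 \<le> b" unfolding b_def using gb by (intro integral_nonneg_AE AE_I2) auto
  have bd: "b \<le> d" 
    using b1 gb by (subst diff_ge_0_iff_ge[symmetric], subst b1[symmetric], intro integral_nonneg_AE AE_I2) auto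
  have L1: "ennreal b \<le> liminf (\<lambda>k. ennreal (a k))"
    unfolding a_def b_def by (rule lower) (use bnd gb lim in auto)
  have L2: "ennreal (d - b) \<le> liminf (\<lambda>k. ennreal (c k - a k))"
    unfolding a1[symmetric] b1[symmetric] 
    by (rule lower) (use bnd gb lim in \<open>auto intro!: tendsto_intros\<close>)
  have ev1: "eventually (\<lambda>k. y < a k) sequentially" if "y < b" for y
  proof (cases "y < 0")
    case True then show ?thesis using a0 by (auto intro!: always_eventually intro: less_le_trans)
  next
    case False
    then have "ennreal y < ennreal b" using that by (simp add: ennreal_less_iff)
    then have "ennreal y < liminf (\<lambda>k. ennreal (a k))" using L1 by (rule less_le_trans)
    from less_LiminfD[OF this] show ?thesis
      by eventually_elim (use False in \<open>auto simp: ennreal_less_iff\<close>)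
  qed
  have ev2: "eventually (\<lambda>k. y < c k - a k) sequentially" if "y < d - b" for y
  proof (cases "y < 0")
    case True then show ?thesis using ac by (auto intro!: always_eventually intro: less_le_trans)
  next
    case False
    then have "ennreal y < ennreal (d - b)" using that by (simp add: ennreal_less_iff)
    then have "ennreal y < liminf (\<lambda>k. ennreal (c k - a k))" using L2 by (rule less_le_trans)
    from less_LiminfD[OF this] show ?thesis
      by eventually_elim (use False in \<open>auto simp: ennreal_less_iff\<close>)
  qed
  have "a \<longlonglongrightarrow> b"
  proof (rule order_tendstoI)
    fix y assume "y < b" then show "eventually (\<lambda>k. y < a k) sequentially" by (rule ev1)
  next
    fix y assume y: "b < y"
    have "eventually (\<lambda>k. d - (b + y) / 2 < c k - a k) sequentially"
      using y by (intro ev2) (auto simp: field_simps)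
    moreover have "eventually (\<lambda>k. c k < d + (y - b) / 2) sequentially"
      using y by (intro order_tendstoD(2)[OF cd]) auto
    ultimately show "eventually (\<lambda>k. a k < y) sequentially"
      by eventually_elim (auto simp: field_simps)
  qed
  then show ?thesis by (simp add: a_def[abs_def] b_def)
qed

lemma finite_measure_PiM:
  assumes "finite_measure L" "finite I"
  shows "finite_measure (PiM I (\<lambda>_. L))"
proof -
  have "product_sigma_finite (\<lambda>_. L)"
    using assms(1) by (auto simp: product_sigma_finite_def finite_measure_def)
  from product_sigma_finite.emeasure_PiM[OF this assms(2), of "\<lambda>_. space L"]
  have "emeasure (PiM I (\<lambda>_. L)) (space (PiM I (\<lambda>_. L))) = ennreal (measure L (space L) ^ card I)"
    using assms(1) by (simp add: space_PiM finite_measure.emeasure_eq_measure ennreal_power)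
  then show ?thesis by (intro finite_measureI) simp
qed

text \<open>Setwise convergence is inherited by finite powers. In the induction step Fubini's theorem gives
  an outer integral over the smaller power, whose measures converge setwise by the induction
  hypothesis, and inner integrals that converge pointwise; the measures and the integrand vary
  simultaneously, as \<open>integral_tendsto_setwise\<close> permits.\<close>
lemma PiM_integral_tendsto_setwise:
  fixes f :: "('i \<Rightarrow> 'b) \<Rightarrow> real"
  assumes "finite I" and conv: "setwise_tendsto M L"
    and "f \<in> borel_measurable (PiM I (\<lambda>_. L))"
    and "\<And>x. x \<in> space (PiM I (\<lambda>_. L)) \<Longrightarrow> f x \<in> {0..1}"
  shows "(\<lambda>k. \<integral>x. f x \<partial>PiM I (\<lambda>_. M k)) \<longlonglongrightarrow> (\<integral>x. f x \<partial>PiM I (\<lambda>_. L))"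
  using assms(1,3,4)
proof (induction I arbitrary: f)
  case empty
  then show ?case by (simp add: PiM_empty)
next
  case (insert i I f)
  have [simp]: "sets (M k) = sets L" for k using conv by (auto simp: setwise_tendsto_def)
  then have [simp]: "space (M k) = space L" for k by (rule sets_eq_imp_space_eq)
  have setsP: "sets (PiM J (\<lambda>_. M k)) = sets (PiM J (\<lambda>_. L))" for J :: "'i set" and k
    by (intro sets_PiM_cong) auto
  have spP: "space (PiM J (\<lambda>_. M k)) = space (PiM J (\<lambda>_. L))" for J :: "'i set" and k
    by (rule sets_eq_imp_space_eq[OF setsP])
  have finM: "finite_measure (M k)" for k using conv by (auto simp: setwise_tendsto_def)
  have finL: "finite_measure L" using conv by (auto simp: setwise_tendsto_def)
  have psM: "product_sigma_finite (\<lambda>_::'i. M k)" for k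
    using finM by (auto simp: product_sigma_finite_def finite_measure_def)
  have psL: "product_sigma_finite (\<lambda>_::'i. L)"
    using finL by (auto simp: product_sigma_finite_def finite_measure_def)
  note fm = insert.prems(1) and fb = insert.prems(2)
  note finP = finite_measure_PiM[OF finM] and finPL = finite_measure_PiM[OF finL]
  have upd: "(\<lambda>(x,y). x(i := y)) \<in> measurable (PiM I (\<lambda>_. L) \<Otimes>\<^sub>M L) (PiM (insert i I) (\<lambda>_. L))"
    using measurable_add_dim[of i I "\<lambda>_. L"] by simp
  have upd_sp: "x(i := y) \<in> space (PiM (insert i I) (\<lambda>_. L))"
    if "x \<in> space (PiM I (\<lambda>_. L))" "y \<in> space L" for x y
    using measurable_space[OF upd, of "(x, y)"] that by (auto simp: space_pair_measure)
  have f2: "(\<lambda>(x,y). f (x(i := y))) \<in> borel_measurable (PiM I (\<lambda>_. L) \<Otimes>\<^sub>M L)"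
    using measurable_comp[OF upd fm] by (simp add: comp_def case_prod_beta)
  have f2M: "(\<lambda>(x,y). f (x(i := y))) \<in> borel_measurable (PiM I (\<lambda>_. L) \<Otimes>\<^sub>M M k)" for k
    using f2 by (simp cong: measurable_cong_sets sets_pair_measure_cong)
  have fsec: "(\<lambda>y. f (x(i := y))) \<in> borel_measurable L" if "x \<in> space (PiM I (\<lambda>_. L))" for x
    using measurable_Pair2[OF f2 that] by simp
  define h where "h k x = (\<integral>y. f (x(i := y)) \<partial>M k)" for k x
  define h' where "h' x = (\<integral>y. f (x(i := y)) \<partial>L)" for x
  have "\<exists>C>0. \<forall>k. measure (M k) (space L) \<le> C \<and> measure L (space L) \<le> C"
  proof -
    have "convergent (\<lambda>k. measure (M k) (space L))"
      using conv by (auto simp: setwise_tendsto_def convergent_def)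
    then obtain K where K: "\<And>k. norm (measure (M k) (space L)) \<le> K"
      using convergent_imp_Bseq[of "\<lambda>k. measure (M k) (space L)"] by (auto simp: Bseq_def)
    show ?thesis
      by (rule exI[of _ "max 1 (max K (measure L (space L)))"]) (use K in \<open>auto simp: le_max_iff_disj\<close>)
  qed
  then obtain C where C: "C > 0" "\<And>k. measure (M k) (space L) \<le> C" "measure L (space L) \<le> C" by auto
  have hm: "h k \<in> borel_measurable (PiM I (\<lambda>_. L))" for k
    unfolding h_def using f2M[of k] finM[of k]
    by (intro sigma_finite_measure.borel_measurable_lebesgue_integral) (auto simp: finite_measure_def)
  have hm': "h' \<in> borel_measurable (PiM I (\<lambda>_. L))"
    unfolding h'_def using f2 finL
    by (intro sigma_finite_measure.borel_measurable_lebesgue_integral) (auto simp: finite_measure_def)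
  have hlim: "(\<lambda>k. h k x) \<longlonglongrightarrow> h' x" if "x \<in> space (PiM I (\<lambda>_. L))" for x
    unfolding h_def h'_def using fb upd_sp[OF that]
    by (intro integral_tendsto_setwise[OF conv]) (auto simp: fsec[OF that])
  have hb: "0 \<le> h k x \<and> h k x \<le> C" if x: "x \<in> space (PiM I (\<lambda>_. L))" for k x
  proof -
    have fb': "0 \<le> f (x(i := y)) \<and> f (x(i := y)) \<le> 1" if "y \<in> space L" for y
    proof -
      have "x(i := y) \<in> space (PiM (insert i I) (\<lambda>_. L))" by (rule upd_sp[OF x that])
      then show ?thesis using fb by auto
    qed
    have "h k x \<le> (\<integral>y. 1 \<partial>M k)"
      unfolding h_def using fb' fsec[OF x] 
      by (intro integral_mono_AE AE_I2 finite_measure.integrable_const_bound[OF finM, of _ 1]) 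
         (auto cong: measurable_cong_sets)
    then show ?thesis
      unfolding h_def using fb' C(2)[of k] by (auto intro!: integral_nonneg_AE AE_I2)
  qed
  have setw: "setwise_tendsto (\<lambda>k. PiM I (\<lambda>_. M k)) (PiM I (\<lambda>_. L))"
    unfolding setwise_tendsto_def
  proof (intro conjI allI ballI)
    show "finite_measure (PiM I (\<lambda>_. L))" by (rule finPL[OF insert.hyps(1)])
    show "finite_measure (PiM I (\<lambda>_. M k))" for k by (rule finP[OF insert.hyps(1)])
    show "sets (PiM I (\<lambda>_. M k)) = sets (PiM I (\<lambda>_. L))" for k by (rule setsP)
    fix A assume A: "A \<in> sets (PiM I (\<lambda>_. L))"
    have "(\<lambda>k. \<integral>x. indicator A x \<partial>PiM I (\<lambda>_. M k)) \<longlonglongrightarrow> (\<integral>x. (indicator A x::real) \<partial>PiM I (\<lambda>_. L))"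
      by (rule insert.IH) (use A in \<open>auto split: split_indicator\<close>)
    then show "(\<lambda>k. measure (PiM I (\<lambda>_. M k)) A) \<longlonglongrightarrow> measure (PiM I (\<lambda>_. L)) A"
      using A sets.sets_into_space[OF A] by (simp add: spP Int_absorb2)
  qed
  have fint: "integrable (PiM (insert i I) (\<lambda>_. M k)) f" for k
    using fm fb insert.hyps
    by (intro finite_measure.integrable_const_bound[OF finP, where B=1] AE_I2) 
       (auto simp: spP cong: measurable_cong_sets[OF setsP])
  have fintL: "integrable (PiM (insert i I) (\<lambda>_. L)) f"
    using fm fb insert.hyps
    by (intro finite_measure.integrable_const_bound[OF finPL, where B=1] AE_I2) auto
  (* The inner integrals are bounded by the total masses, so dividing by C brings them into [0,1]. *)
  have "(\<lambda>k. \<integral>x. h k x / C \<partial>PiM I (\<lambda>_. M k)) \<longlonglongrightarrow> (\<integral>x. h' x / C \<partial>PiM I (\<lambda>_. L))"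
    using hm hm' hb C(1) by (intro integral_tendsto_setwise[OF setw] tendsto_divide hlim) auto
  from tendsto_mult[OF tendsto_const[of C] this]
  have "(\<lambda>k. \<integral>x. h k x \<partial>PiM I (\<lambda>_. M k)) \<longlonglongrightarrow> (\<integral>x. h' x \<partial>PiM I (\<lambda>_. L))"
    using C(1) by simp
  then show ?case
    unfolding h_def h'_def
    by (simp add: product_sigma_finite.product_integral_insert[OF psM insert.hyps fint]
        product_sigma_finite.product_integral_insert[OF psL insert.hyps fintL])
qed

section \<open>Configurations\<close>

text \<open>The counts of the sets in \<open>N\<close> alone generate a sub-sigma-algebra of the configuration space; every
  test turns out to be measurable for such a sub-sigma-algebra with countably generated \<open>N\<close>.\<close>
definition config_space_on :: "'a::t2_space measure \<Rightarrow> 'a measure measure" where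
  "config_space_on N = sigma configurations
     {{\<kappa> \<in> configurations. measure \<kappa> B \<in> A} | A B. A \<in> sets borel \<and> B \<in> sets N}"

lemma configuration_space_eq: "configuration_space = config_space_on borel"
  by (simp add: configuration_space_def config_space_on_def)

lemma space_config_space_on [simp]: "space (config_space_on N) = configurations"
  by (simp add: config_space_on_def space_measure_of_conv)

lemma space_configuration_space [simp]: "space configuration_space = configurations"
  by (simp add: configuration_space_eq)

lemma sets_config_space_on:
  "sets (config_space_on N) = sigma_sets configurations
     {{\<kappa> \<in> configurations. measure \<kappa> B \<in> A} | A B. A \<in> sets borel \<and> B \<in> sets N}"
  unfolding config_space_on_def by (rule sets_measure_of) auto

lemma measurable_count [measurable]:
  "B \<in> sets N \<Longrightarrow> (\<lambda>\<kappa>. measure \<kappa> B) \<in> borel_measurable (config_space_on N)"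
  by (rule measurableI) (auto simp: sets_config_space_on vimage_def Int_def conj_commute)

lemma measurable_count_borel [measurable]:
  "B \<in> sets borel \<Longrightarrow> (\<lambda>\<kappa>. measure \<kappa> B) \<in> borel_measurable configuration_space"
  unfolding configuration_space_eq by (rule measurable_count)

lemma measurable_into_config_space_on:
  assumes "\<And>x. x \<in> space M \<Longrightarrow> f x \<in> configurations"
    and "\<And>B. B \<in> sets N \<Longrightarrow> (\<lambda>x. measure (f x) B) \<in> borel_measurable M"
  shows "f \<in> measurable M (config_space_on N)"
proof (rule measurable_sigma_sets[OF sets_config_space_on])
  fix Z assume "Z \<in> {{\<kappa> \<in> configurations. measure \<kappa> B \<in> A} | A B. A \<in> sets borel \<and> B \<in> sets N}"
  then obtain A B where Z: "Z = {\<kappa> \<in> configurations. measure \<kappa> B \<in> A}" "A \<in> sets borel" "B \<in> sets N"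
    by auto
  have "f -` Z \<inter> space M = (\<lambda>x. measure (f x) B) -` A \<inter> space M"
    using assms(1) by (auto simp: Z)
  also have "\<dots> \<in> sets M"
    using assms(2)[OF Z(3)] Z(2) by (rule measurable_sets)
  finally show "f -` Z \<inter> space M \<in> sets M" .
qed (use assms(1) in auto)

text \<open>The counting measure of the points \<open>x 0, \<dots>, x (m - 1)\<close>, repetitions included.\<close>
definition point_config :: "nat \<Rightarrow> (nat \<Rightarrow> 'a::t2_space) \<Rightarrow> 'a measure" where
  "point_config m x = distr (count_space {..<m}) borel x"

lemma emeasure_point_config:
  assumes "B \<in> sets borel"
  shows "emeasure (point_config m x) B = of_nat (card {i\<in>{..<m}. x i \<in> B})"
  unfolding point_config_def using assms
proof (subst emeasure_distr)
  have "x -` B \<inter> space (count_space {..<m}) = {i\<in>{..<m}. x i \<in> B}" by auto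
  then show "emeasure (count_space {..<m}) (x -` B \<inter> space (count_space {..<m})) = of_nat (card {i\<in>{..<m}. x i \<in> B})"
    by (simp only:) (subst emeasure_count_space_finite, auto)
qed auto

lemma measure_point_config:
  assumes "B \<in> sets borel"
  shows "measure (point_config m x) B = real (card {i\<in>{..<m}. x i \<in> B})"
  by (simp add: measure_def emeasure_point_config[OF assms])

lemma point_config_in_configurations: "point_config m x \<in> configurations"
proof -
  have "finite_measure (point_config m x)"
    by (rule finite_measureI)
       (simp add: emeasure_point_config point_config_def[THEN arg_cong[of _ _ space]])
  moreover have "sets (point_config m x) = sets borel" by (simp add: point_config_def)
  ultimately show ?thesis
    by (auto simp: configurations_def finite_measures_def measure_point_config)
qed

text \<open>Stated for a sub-sigma-algebra \<open>N\<close>, so that events determined by counts of sets in \<open>N\<close> pull back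
  to events in the powers of \<open>N\<close>, the only ones on which mean measures will converge.\<close>
lemma measurable_point_config:
  assumes "sets N \<subseteq> sets borel"
  shows "point_config m \<in> measurable (PiM {..<m} (\<lambda>_. N)) (config_space_on N)"
proof (rule measurable_into_config_space_on)
  fix B assume B: "B \<in> sets N"
  then have [measurable]: "(\<lambda>x. indicator B (x i) :: real) \<in> borel_measurable (PiM {..<m} (\<lambda>_. N))"
    if "i < m" for i
    using that B by (intro measurable_compose[OF measurable_component_singleton borel_measurable_indicator]) auto
  have "measure (point_config m x) B = (\<Sum>i<m. indicator B (x i))" for x
    using assms B by (subst measure_point_config) (auto simp: indicator_def sum.If_cases Int_def)
  then show "(\<lambda>x. measure (point_config m x) B) \<in> borel_measurable (PiM {..<m} (\<lambda>_. N))"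
    by simp
qed (rule point_config_in_configurations)

section \<open>Existence of the Poisson law\<close>
lemma suminf_ennreal_swap:
  fixes f :: "nat \<Rightarrow> nat \<Rightarrow> ennreal"
  shows "(\<Sum>i. \<Sum>j. f i j) = (\<Sum>j. \<Sum>i. f i j)"
proof -
  have "(\<integral>\<^sup>+j. (\<Sum>i. f i j) \<partial>count_space UNIV) = (\<Sum>i. \<integral>\<^sup>+j. f i j \<partial>count_space UNIV)"
    by (rule nn_integral_suminf) auto
  then show ?thesis by (simp add: nn_integral_count_space_nat)
qed

text \<open>The law of a Poisson number of independent points. Powers of the unnormalised measure \<open>\<mu>\<close> are
  used: with \<open>\<mu> = r * p\<close> for a probability measure \<open>p\<close> and \<open>r = \<mu> UNIV\<close>, the \<open>m\<close>-th term is
  \<open>exp (- r) * r\<^sup>m / m!\<close> times the probability under \<open>p\<^sup>m\<close>. This form is also meaningful for \<open>\<mu> = 0\<close>.\<close>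
definition poisson_mixture :: "'a::t2_space measure \<Rightarrow> 'a measure measure" where
  "poisson_mixture \<mu> = measure_of configurations (sets configuration_space)
     (\<lambda>A. \<Sum>m. ennreal (exp (- measure \<mu> UNIV) / fact m) *
        emeasure (PiM {..<m} (\<lambda>_. \<mu>)) (point_config m -` A \<inter> space (PiM {..<m} (\<lambda>_. \<mu>))))"

lemma sets_poisson_mixture [simp]: "sets (poisson_mixture \<mu>) = sets configuration_space"
  unfolding poisson_mixture_def
  using sets.space_closed[of configuration_space] sets.sigma_sets_eq[of configuration_space] 
  by (subst sets_measure_of) simp_all

lemma space_poisson_mixture [simp]: "space (poisson_mixture \<mu>) = configurations"
  using sets_eq_imp_space_eq[OF sets_poisson_mixture] by simp

lemma measurable_point_config_finite_measure:
  assumes "\<mu> \<in> finite_measures"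
  shows "point_config m \<in> measurable (PiM {..<m} (\<lambda>_. \<mu>)) configuration_space"
proof -
  have "sets \<mu> = sets borel" using assms by (simp add: finite_measures_def)
  then have "sets (PiM {..<m} (\<lambda>_. \<mu>)) = sets (PiM {..<m} (\<lambda>_. borel))"
    by (intro sets_PiM_cong) auto
  then show ?thesis
    using measurable_point_config[of borel m] by (simp add: configuration_space_eq cong: measurable_cong_sets)
qed

lemma emeasure_poisson_mixture:
  assumes \<mu>: "\<mu> \<in> finite_measures" and A: "A \<in> sets configuration_space"
  shows "emeasure (poisson_mixture \<mu>) A = (\<Sum>m. ennreal (exp (- measure \<mu> UNIV) / fact m) *
        emeasure (PiM {..<m} (\<lambda>_. \<mu>)) (point_config m -` A \<inter> space (PiM {..<m} (\<lambda>_. \<mu>))))"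
    (is "_ = ?F A")
  unfolding poisson_mixture_def
proof (rule emeasure_measure_of_sigma)
  show "sigma_algebra configurations (sets configuration_space)"
    using sets.sigma_algebra_axioms[of configuration_space] by simp
  show "positive (sets configuration_space) ?F" by (simp add: positive_def)
  show "countably_additive (sets configuration_space) ?F"
  proof (rule countably_additiveI)
    fix A :: "nat \<Rightarrow> 'a measure set"
    assume A: "range A \<subseteq> sets configuration_space" "disjoint_family A"
    have "(\<Sum>i. ?F (A i)) = (\<Sum>m. \<Sum>i. ennreal (exp (- measure \<mu> UNIV) / fact m) *
        emeasure (PiM {..<m} (\<lambda>_. \<mu>)) (point_config m -` A i \<inter> space (PiM {..<m} (\<lambda>_. \<mu>))))"
      by (rule suminf_ennreal_swap)
    also have "\<dots> = ?F (\<Union>i. A i)"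
    proof (rule suminf_cong)
      fix m
      have "(\<Sum>i. emeasure (PiM {..<m} (\<lambda>_. \<mu>)) (point_config m -` A i \<inter> space (PiM {..<m} (\<lambda>_. \<mu>))))
         = emeasure (PiM {..<m} (\<lambda>_. \<mu>)) (\<Union>i. point_config m -` A i \<inter> space (PiM {..<m} (\<lambda>_. \<mu>)))"
        using A measurable_sets[OF measurable_point_config_finite_measure[OF \<mu>, of m]]
        by (intro suminf_emeasure) (auto simp: disjoint_family_on_def)
      moreover have "(\<Union>i. point_config m -` A i \<inter> space (PiM {..<m} (\<lambda>_. \<mu>)))
         = point_config m -` (\<Union>i. A i) \<inter> space (PiM {..<m} (\<lambda>_. \<mu>))" by auto
      ultimately show "(\<Sum>i. ennreal (exp (- measure \<mu> UNIV) / fact m) *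
        emeasure (PiM {..<m} (\<lambda>_. \<mu>)) (point_config m -` A i \<inter> space (PiM {..<m} (\<lambda>_. \<mu>))))
        = ennreal (exp (- measure \<mu> UNIV) / fact m) *
        emeasure (PiM {..<m} (\<lambda>_. \<mu>)) (point_config m -` (\<Union>i. A i) \<inter> space (PiM {..<m} (\<lambda>_. \<mu>)))"
        by simp
    qed
    finally show "(\<Sum>i. ?F (A i)) = ?F (\<Union>i. A i)" .
  qed
qed (fact A)

text \<open>The samples of \<open>m\<close> points of which exactly \<open>k j\<close> fall into the cell \<open>D j\<close>, for every \<open>j\<close>.\<close>
definition cell_counts :: "nat \<Rightarrow> nat set \<Rightarrow> (nat \<Rightarrow> 'a set) \<Rightarrow> (nat \<Rightarrow> nat) \<Rightarrow> (nat \<Rightarrow> 'a) set" where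
  "cell_counts m J D k = {x. \<forall>j\<in>J. card {i\<in>{..<m}. x i \<in> D j} = k j}"

text \<open>The multinomial formula, by induction on the number of points: the last point falls into
  exactly one cell \<open>D j\<close>, and the others must then realise \<open>k\<close> with \<open>k j\<close> lowered by one. Writing
  \<open>q\<close> for the product, the \<open>j\<close>-th summand equals \<open>m! * k j * q\<close>, and these add up to
  \<open>(m + 1)! * q\<close> because the \<open>k j\<close> add up to \<open>m + 1\<close>.\<close>
lemma measure_cell_counts:
  fixes \<mu> :: "'a measure"
  assumes fin: "finite_measure \<mu>" and sp: "space \<mu> = UNIV" and J: "finite J"
    and D: "\<And>j. j \<in> J \<Longrightarrow> D j \<in> sets \<mu>" "disjoint_family_on D J" "(\<Union>j\<in>J. D j) = UNIV"
  shows "cell_counts m J D k \<inter> space (PiM {..<m} (\<lambda>_. \<mu>)) \<in> sets (PiM {..<m} (\<lambda>_. \<mu>)) \<and>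
     measure (PiM {..<m} (\<lambda>_. \<mu>)) (cell_counts m J D k \<inter> space (PiM {..<m} (\<lambda>_. \<mu>))) =
     (if sum k J = m then fact m * (\<Prod>j\<in>J. measure \<mu> (D j) ^ k j / fact (k j)) else 0)"
proof (induction m arbitrary: k)
  case 0
  have "cell_counts 0 J D k = (if sum k J = 0 then UNIV else {})"
    using J by (auto simp: cell_counts_def)
  then show ?case using J
    by (auto simp: PiM_empty)
next
  case (Suc m)
  note IH = Suc.IH
  let ?P = "\<lambda>m. PiM {..<m} (\<lambda>_::nat. \<mu>)"
  interpret finite_measure \<mu> by fact
  interpret P: product_sigma_finite "\<lambda>_::nat. \<mu>"
    using fin by (auto simp: product_sigma_finite_def finite_measure_def)
  have finP: "finite_measure (?P m)" for m
    by (rule finite_measure_PiM[OF fin]) simp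
  have card_eq: "card {i\<in>{..<m}. x i \<in> B} = (\<Sum>i<m. if x i \<in> B then 1 else 0)" for x :: "nat \<Rightarrow> 'a" and B and m
    by (simp add: sum.If_cases Int_def)
  have meas: "cell_counts m J D k \<inter> space (?P m) \<in> sets (?P m)" for m k
  proof -
    have [measurable]: "(\<lambda>x. x i \<in> D j) \<in> measurable (?P m) (count_space UNIV)" if "j \<in> J" "i < m" for i j
      by (rule measurable_compose[OF measurable_component_singleton]) (use D(1)[OF that(1)] that in auto)
    have "cell_counts m J D k \<inter> space (?P m) = {x\<in>space (?P m). \<forall>j\<in>J. (\<Sum>i<m. if x i \<in> D j then 1 else 0) = k j}"
      unfolding cell_counts_def card_eq by auto
    also have "\<dots> \<in> sets (?P m)"
      using J by measurable
    finally show ?thesis .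
  qed
  have upd: "(indicator (cell_counts (Suc m) J D k) (x(m := y)) :: real) =
     (\<Sum>j\<in>J. indicator (D j) y * (if k j > 0 then indicator (cell_counts m J D (k(j := k j - 1))) x else 0))" for x y
  proof -
    obtain l where l: "l \<in> J" "y \<in> D l" using D(3) by blast
    have uniq: "y \<in> D j \<longleftrightarrow> j = l" if "j \<in> J" for j
      using D(2) l that by (auto simp: disjoint_family_on_def)
    have cnt: "card {i\<in>{..<Suc m}. (x(m := y)) i \<in> D j} = card {i\<in>{..<m}. x i \<in> D j} + (if j = l then 1 else 0)"
      if "j \<in> J" for j
      unfolding card_eq using uniq[OF that] by simp
    have "(\<Sum>j\<in>J. indicator (D j) y * (if k j > 0 then indicator (cell_counts m J D (k(j := k j - 1))) x else 0)) =
       (\<Sum>j\<in>J. if j = l then (if k l > 0 then indicator (cell_counts m J D (k(l := k l - 1))) x else 0) else (0::real))"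
      by (intro sum.cong) (auto simp: uniq)
    also have "\<dots> = (if k l > 0 then indicator (cell_counts m J D (k(l := k l - 1))) x else 0)"
      using J l by simp
    also have "\<dots> = indicator (cell_counts (Suc m) J D k) (x(m := y))"
      using l(1) cnt by (auto simp: cell_counts_def indicator_def)
    finally show ?thesis ..
  qed
  define a where "a m k = measure (?P m) (cell_counts m J D k \<inter> space (?P m))" for m k
  have int: "integrable (?P m) (indicator (cell_counts m J D k) :: _ \<Rightarrow> real)" for m k
    using meas[of m k] by (intro finite_measure.integrable_const_bound[OF finP, of _ 1] AE_I2)
       (auto simp: indicator_def borel_measurable_indicator_iff)
  have int_eq: "(\<integral>x. indicator (cell_counts m J D k) x \<partial>?P m) = a m k" for m k
    unfolding a_def by simp
  have "a (Suc m) k = (\<integral>x. indicator (cell_counts (Suc m) J D k) x \<partial>?P (Suc m))"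
    by (rule int_eq[symmetric])
  also have "\<dots> = (\<integral>x. \<integral>y. indicator (cell_counts (Suc m) J D k) (x(m := y)) \<partial>\<mu> \<partial>?P m)"
    using P.product_integral_insert[of "{..<m}" m, OF _ _ int[of "Suc m" k, unfolded lessThan_Suc]]
    by (simp add: lessThan_Suc)
  also have "\<dots> = (\<integral>x. (\<Sum>j\<in>J. measure \<mu> (D j) * (if k j > 0 then indicator (cell_counts m J D (k(j := k j - 1))) x else 0)) \<partial>?P m)"
    unfolding upd
  proof (intro Bochner_Integration.integral_cong refl)
    fix x
    show "(\<integral>y. (\<Sum>j\<in>J. indicator (D j) y * (if k j > 0 then indicator (cell_counts m J D (k(j := k j - 1))) x else 0)) \<partial>\<mu>)
      = (\<Sum>j\<in>J. measure \<mu> (D j) * (if k j > 0 then indicator (cell_counts m J D (k(j := k j - 1))) x else (0::real)))"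
      using D(1) sp by (subst Bochner_Integration.integral_sum) (auto simp: emeasure_eq_measure)
  qed
  also have "\<dots> = (\<Sum>j\<in>J. measure \<mu> (D j) * (if k j > 0 then a m (k(j := k j - 1)) else 0))"
  proof -
    define F :: "nat \<Rightarrow> (nat \<Rightarrow> 'a) \<Rightarrow> real" where
      "F j x = (if k j > 0 then indicator (cell_counts m J D (k(j := k j - 1))) x else 0)" for j x
    have F1: "integrable (?P m) (F j)" for j
      unfolding F_def[abs_def] using int[of m] by (cases "k j > 0") auto
    have F2: "integral\<^sup>L (?P m) (F j) = (if k j > 0 then a m (k(j := k j - 1)) else 0)" for j
      unfolding F_def[abs_def] using int_eq[of m "k(j := k j - 1)"] by (cases "k j > 0") (simp_all only: if_True if_False integral_zero)
    have "(\<integral>x. (\<Sum>j\<in>J. measure \<mu> (D j) * F j x) \<partial>?P m) = (\<Sum>j\<in>J. measure \<mu> (D j) * integral\<^sup>L (?P m) (F j))"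
      using F1 by (subst Bochner_Integration.integral_sum) auto
    then show ?thesis unfolding F2 unfolding F_def .
  qed
  finally have rec: "a (Suc m) k = (\<Sum>j\<in>J. measure \<mu> (D j) * (if k j > 0 then a m (k(j := k j - 1)) else 0))" .
  define q where "q k = (\<Prod>j\<in>J. measure \<mu> (D j) ^ k j / fact (k j))" for k
  have summand: "measure \<mu> (D j) * (if k j > 0 then a m (k(j := k j - 1)) else 0) =
      (if sum k J = Suc m then fact m * real (k j) * q k else 0)" if j: "j \<in> J" for j
  proof (cases "k j")
    case 0 then show ?thesis by simp
  next
    case (Suc r)
    have s: "sum (k(j := r)) J = m \<longleftrightarrow> sum k J = Suc m"
      using J j Suc by (simp add: sum.remove[OF J j]) 
    have "(\<Prod>i\<in>J - {j}. measure \<mu> (D i) ^ (k(j := r)) i / fact ((k(j := r)) i)) = (\<Prod>i\<in>J - {j}. measure \<mu> (D i) ^ k i / fact (k i))"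
      by (intro prod.cong) auto
    then have "measure \<mu> (D j) * q (k(j := r)) = real (k j) * q k"
      unfolding q_def by (simp add: prod.remove[OF J j] Suc field_simps del: of_nat_Suc) 
    then show ?thesis
      using Suc IH[of "k(j := r)"] s unfolding a_def[symmetric] q_def[symmetric]
      by auto
  qed
  have "a (Suc m) k = (\<Sum>j\<in>J. if sum k J = Suc m then fact m * real (k j) * q k else 0)"
    unfolding rec by (intro sum.cong refl summand)
  also have "\<dots> = (if sum k J = Suc m then fact (Suc m) * q k else 0)"
    by (auto simp: sum_distrib_left[symmetric] sum_distrib_right[symmetric] of_nat_sum[symmetric] simp del: of_nat_sum)
  finally show ?case using meas[of "Suc m" k] by (simp add: a_def q_def)
qed

text \<open>\<^const>\<open>poisson_pmf\<close> requires a positive rate; a Borel set of measure 0 has the degenerate law.\<close>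
definition pois :: "real \<Rightarrow> nat pmf" where
  "pois r = (if r > 0 then poisson_pmf r else return_pmf 0)"

lemma pmf_pois: "r \<ge> 0 \<Longrightarrow> pmf (pois r) k = r ^ k / fact k * exp (- r)"
  by (cases "k = 0") (auto simp: pois_def)

lemma counts_event_in_sets:
  assumes "finite J" "\<And>j. j \<in> J \<Longrightarrow> D j \<in> sets borel"
  shows "{\<kappa> \<in> configurations. \<forall>j\<in>J. measure \<kappa> (D j) = real (k j)} \<in> sets configuration_space"
proof -
  have [measurable]: "(\<lambda>\<kappa>. measure \<kappa> (D j)) \<in> borel_measurable configuration_space" if "j \<in> J" for j
    using assms(2)[OF that] by measurable
  have "{\<kappa> \<in> space configuration_space. \<forall>j\<in>J. measure \<kappa> (D j) = real (k j)} \<in> sets configuration_space"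
    using assms(1) by measurable
  then show ?thesis by simp
qed

text \<open>If the cells partition the whole space, only samples with \<open>m = sum k J\<close> points contribute. The
  factor \<open>m!\<close> of the multinomial formula cancels the one in the mixture, and \<open>exp (- \<mu> UNIV)\<close>
  factorises over the cells.\<close>
lemma emeasure_poisson_mixture_partition:
  fixes J :: "nat set"
  assumes \<mu>: "\<mu> \<in> finite_measures" and J: "finite J"
    and D: "\<And>j. j \<in> J \<Longrightarrow> D j \<in> sets borel" "disjoint_family_on D J" "(\<Union>j\<in>J. D j) = UNIV"
  shows "emeasure (poisson_mixture \<mu>) {\<kappa> \<in> configurations. \<forall>j\<in>J. measure \<kappa> (D j) = real (k j)} =
     ennreal (\<Prod>j\<in>J. pmf (pois (measure \<mu> (D j))) (k j))"
proof -
  let ?A = "{\<kappa> \<in> configurations. \<forall>j\<in>J. measure \<kappa> (D j) = real (k j)}"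
  let ?P = "\<lambda>m. PiM {..<m} (\<lambda>_::nat. \<mu>)"
  have sets[simp]: "sets \<mu> = sets borel" and fin: "finite_measure \<mu>"
    using \<mu> by (auto simp: finite_measures_def)
  interpret finite_measure \<mu> by fact
  have sp: "space \<mu> = UNIV" using sets_eq_imp_space_eq[OF sets] by simp
  interpret P: product_sigma_finite "\<lambda>_::nat. \<mu>"
    using fin by (auto simp: product_sigma_finite_def finite_measure_def)
  have vim: "point_config m -` ?A \<inter> space (?P m) = cell_counts m J D k \<inter> space (?P m)" for m
    using D(1) point_config_in_configurations by (auto simp: cell_counts_def measure_point_config)
  have finP: "finite_measure (?P m)" for m
    by (rule finite_measure_PiM[OF fin]) simp
  define q where "q = (\<Prod>j\<in>J. measure \<mu> (D j) ^ k j / fact (k j))"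
  have em: "emeasure (?P m) (cell_counts m J D k \<inter> space (?P m)) = ennreal (if sum k J = m then fact m * q else 0)" for m
    using measure_cell_counts[OF fin sp J _ D(2,3), of m k] D(1) 
    by (simp add: finite_measure.emeasure_eq_measure[OF finP] q_def)
  have q0: "0 \<le> q" unfolding q_def by (intro prod_nonneg) auto
  have "measure \<mu> UNIV = (\<Sum>j\<in>J. measure \<mu> (D j))"
    using finite_measure_finite_Union[OF J _ D(2)] D(1,3) by auto
  then have e: "exp (- measure \<mu> UNIV) = (\<Prod>j\<in>J. exp (- measure \<mu> (D j)))"
    using J by (simp add: exp_sum sum_negf[symmetric])
  have "emeasure (poisson_mixture \<mu>) ?A = (\<Sum>m. ennreal (exp (- measure \<mu> UNIV) / fact m) * emeasure (?P m) (point_config m -` ?A \<inter> space (?P m)))"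
    by (intro emeasure_poisson_mixture[OF \<mu>] counts_event_in_sets[OF J] D(1))
  also have "\<dots> = (\<Sum>m. ennreal (exp (- measure \<mu> UNIV) / fact m) * ennreal (if sum k J = m then fact m * q else 0))"
    by (simp only: vim em)
  also have "\<dots> = (\<Sum>m\<in>{sum k J}. ennreal (exp (- measure \<mu> UNIV) / fact m) * ennreal (if sum k J = m then fact m * q else 0))"
    by (rule suminf_finite) auto
  also have "\<dots> = ennreal (exp (- measure \<mu> UNIV) * q)"
    using q0 by (simp add: ennreal_mult'[symmetric])
  also have "exp (- measure \<mu> UNIV) * q = (\<Prod>j\<in>J. pmf (pois (measure \<mu> (D j))) (k j))"
    by (simp add: e q_def pmf_pois prod.distrib[symmetric] mult.commute)
  finally show ?thesis .
qed

text \<open>Sets of counts in place of single values: both sides add up the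
  probabilities of the count vectors in the product of the sets \<open>S j\<close>, of which there are countably
  many.\<close>
lemma emeasure_poisson_mixture_partition_sets:
  fixes J :: "nat set"
  assumes \<mu>: "\<mu> \<in> finite_measures" and J: "finite J"
    and D: "\<And>j. j \<in> J \<Longrightarrow> D j \<in> sets borel" "disjoint_family_on D J" "(\<Union>j\<in>J. D j) = UNIV"
  shows "emeasure (poisson_mixture \<mu>) {\<kappa> \<in> configurations. \<forall>j\<in>J. \<exists>k\<in>S j. measure \<kappa> (D j) = real k} =
     ennreal (\<Prod>j\<in>J. measure_pmf.prob (pois (measure \<mu> (D j))) (S j))"
proof -
  let ?E = "\<lambda>k. {\<kappa> \<in> configurations. \<forall>j\<in>J. measure \<kappa> (D j) = real (k j)}"
  let ?p = "Pi_pmf J undefined (\<lambda>j. pois (measure \<mu> (D j)))"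
  have PiE: "PiE J S = PiE_dflt J undefined S"
    by (auto simp: PiE_dflt_def PiE_def extensional_def)
  have "{\<kappa> \<in> configurations. \<forall>j\<in>J. \<exists>k\<in>S j. measure \<kappa> (D j) = real k} = (\<Union>k\<in>PiE J S. ?E k)" (is "?L = ?R")
  proof (intro equalityI subsetI)
    fix \<kappa> :: "'a measure" assume \<kappa>: "\<kappa> \<in> ?L"
    then have "\<forall>j\<in>J. \<exists>k. k \<in> S j \<and> measure \<kappa> (D j) = real k" by auto
    from bchoice[OF this] obtain k where "\<forall>j\<in>J. k j \<in> S j \<and> measure \<kappa> (D j) = real (k j)" ..
    with \<kappa> have "restrict k J \<in> PiE J S" "\<kappa> \<in> ?E (restrict k J)" by auto
    then show "\<kappa> \<in> ?R" by blast
  next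
    fix \<kappa> assume "\<kappa> \<in> ?R"
    then show "\<kappa> \<in> ?L" by (auto dest: PiE_mem)
  qed
  also have "emeasure (poisson_mixture \<mu>) \<dots> = (\<integral>\<^sup>+k. emeasure (poisson_mixture \<mu>) (?E k) \<partial>count_space (PiE J S))"
  proof (rule emeasure_UN_countable)
    show "countable (PiE J S)" using J by (intro countable_PiE) auto
    show "disjoint_family_on ?E (PiE J S)"
      unfolding disjoint_family_on_def
    proof (intro ballI impI)
      fix k l assume "k \<in> PiE J S" "l \<in> PiE J S" "k \<noteq> l"
      then obtain j where "j \<in> J" "k j \<noteq> l j" by (metis PiE_ext)
      then show "?E k \<inter> ?E l = {}" by auto
    qed
  qed (use counts_event_in_sets[OF J D(1)] in simp)
  also have "\<dots> = (\<integral>\<^sup>+k. ennreal (pmf ?p k) \<partial>count_space (PiE J S))"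
    using D J by (intro nn_integral_cong)
       (auto simp: emeasure_poisson_mixture_partition[OF \<mu>] PiE PiE_dflt_def intro!: arg_cong[where f=ennreal] pmf_Pi'[symmetric])
  also have "\<dots> = emeasure ?p (PiE J S)"
    by (rule nn_integral_pmf)
  also have "\<dots> = ennreal (\<Prod>j\<in>J. measure_pmf.prob (pois (measure \<mu> (D j))) (S j))"
    unfolding measure_pmf.emeasure_eq_measure PiE using J by (simp add: measure_Pi_pmf_PiE_dflt)
  finally show ?thesis .
qed

lemma prob_space_poisson_mixture:
  assumes \<mu>: "\<mu> \<in> finite_measures"
  shows "prob_space (poisson_mixture \<mu>)"
proof
  have "configurations = {\<kappa> \<in> configurations. \<forall>j\<in>{0::nat}. \<exists>k\<in>UNIV. measure \<kappa> (UNIV :: 'a set) = real k}"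
    by (auto simp: configurations_def Nats_def)
  then show "emeasure (poisson_mixture \<mu>) (space (poisson_mixture \<mu>)) = 1"
    using emeasure_poisson_mixture_partition_sets[OF \<mu>, of "{0}" "\<lambda>_. UNIV" "\<lambda>_. UNIV"]
    by (simp add: disjoint_family_on_def)
qed

lemma configuration_count_nat:
  assumes "\<kappa> \<in> configurations" "B \<in> sets borel"
  obtains k where "measure \<kappa> B = real k"
  using assms by (auto simp: configurations_def Nats_def)

text \<open>A disjoint family need not cover the space. Adding the complement of its union as one more cell
  reduces independence of the counts to the case of a partition.\<close>
lemma poisson_process_poisson_mixture:
  assumes \<mu>: "\<mu> \<in> finite_measures"
  shows "poisson_process (poisson_mixture \<mu>) (\<lambda>\<kappa>. \<kappa>) \<mu>"
proof -
  interpret prob_space "poisson_mixture \<mu>" by (rule prob_space_poisson_mixture[OF \<mu>])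
  have count: "prob {\<kappa> \<in> configurations. \<forall>j\<in>J. measure \<kappa> (D j) \<in> A j} =
     (\<Prod>j\<in>J. measure_pmf.prob (pois (measure \<mu> (D j))) {k. real k \<in> A j})"
    if "finite J" "\<And>j. j \<in> J \<Longrightarrow> D j \<in> sets borel" "disjoint_family_on D J" "(\<Union>j\<in>J. D j) = UNIV" 
    for J :: "nat set" and D A
  proof -
    note D = that(2)
    have "{\<kappa> \<in> configurations. \<forall>j\<in>J. measure \<kappa> (D j) \<in> A j} =
      {\<kappa> \<in> configurations. \<forall>j\<in>J. \<exists>k\<in>{k. real k \<in> A j}. measure \<kappa> (D j) = real k}"
    proof (intro Collect_cong conj_cong ball_cong refl)
      fix \<kappa> :: "'a measure" and j assume \<kappa>: "\<kappa> \<in> configurations" and j: "j \<in> J"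
      obtain k where "measure \<kappa> (D j) = real k" by (rule configuration_count_nat[OF \<kappa> D[OF j]])
      then show "measure \<kappa> (D j) \<in> A j \<longleftrightarrow> (\<exists>k\<in>{k. real k \<in> A j}. measure \<kappa> (D j) = real k)" by auto
    qed
    then show ?thesis
      using emeasure_poisson_mixture_partition_sets[OF \<mu> that, of "\<lambda>j. {k. real k \<in> A j}"]
      by (simp add: emeasure_eq_measure prod_nonneg)
  qed
  have single: "prob {\<kappa> \<in> configurations. measure \<kappa> B \<in> A} = measure_pmf.prob (pois (measure \<mu> B)) {k. real k \<in> A}"
    if B: "B \<in> sets borel" for B A
    using count[of "{0,1}" "\<lambda>j. if j = 0 then B else - B" "\<lambda>j. if j = 0 then A else UNIV"] B
    by (auto simp: disjoint_family_on_def)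
  show ?thesis
    unfolding poisson_process_def
  proof (intro conjI ballI allI impI)
    show "prob_space (poisson_mixture \<mu>)" by (rule prob_space_axioms)
    show "(\<lambda>\<kappa>. \<kappa>) \<in> measurable (poisson_mixture \<mu>) configuration_space"
      by (simp cong: measurable_cong_sets)
    fix B :: "'a set" and k assume "B \<in> sets borel"
    then show "prob {\<kappa> \<in> space (poisson_mixture \<mu>). measure \<kappa> B = real k} =
       measure \<mu> B ^ k / fact k * exp (- measure \<mu> B)"
      using single[of B "{real k}"] by (simp add: pmf_pois measure_pmf_single)
  next
    fix I :: "nat set" and B :: "nat \<Rightarrow> 'a set"
    assume I: "finite I" "B ` I \<subseteq> sets borel" "disjoint_family_on B I"
    obtain r where r: "r \<notin> I" using ex_new_if_finite[OF _ I(1)] by auto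
    define D where "D = B(r := - (\<Union>i\<in>I. B i))"
    define J where "J = insert r I"
    have J: "finite J" "J \<noteq> {}" using I by (auto simp: J_def)
    have "(\<Union>i\<in>I. B i) \<in> sets borel" using I by (intro sets.finite_UN) auto
    then have "- (\<Union>i\<in>I. B i) \<in> sets borel" by (rule borel_comp)
    then have D: "D j \<in> sets borel" if "j \<in> J" for j using that I(2) r by (cases "j = r") (auto simp: D_def J_def simp del: Compl_UN)
    have DI: "D i = B i" if "i \<in> I" for i using that r by (auto simp: D_def)
    have disj: "disjoint_family_on D J"
      using I(3) r by (auto simp: disjoint_family_on_def D_def J_def)
    have cov: "(\<Union>j\<in>J. D j) = UNIV"
      using r DI by (auto simp: J_def) (auto simp: D_def)
    have "indep_vars (\<lambda>_. borel) (\<lambda>i \<kappa>. measure \<kappa> (D i)) J"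
    proof (subst indep_vars_finite[where E="\<lambda>_. sets borel"])
      show "random_variable borel (\<lambda>\<kappa>. measure \<kappa> (D i))" if "i \<in> J" for i
        using measurable_count_borel[OF D[OF that]] by (simp cong: measurable_cong_sets)
      show "\<forall>A\<in>J \<rightarrow> sets borel. prob (\<Inter>j\<in>J. (\<lambda>\<kappa>. measure \<kappa> (D j)) -` A j \<inter> space (poisson_mixture \<mu>)) =
        (\<Prod>j\<in>J. prob ((\<lambda>\<kappa>. measure \<kappa> (D j)) -` A j \<inter> space (poisson_mixture \<mu>)))"
      proof
        fix A :: "nat \<Rightarrow> real set" assume "A \<in> J \<rightarrow> sets borel"
        have e1: "(\<Inter>j\<in>J. (\<lambda>\<kappa>. measure \<kappa> (D j)) -` A j \<inter> space (poisson_mixture \<mu>)) =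
          {\<kappa> \<in> configurations. \<forall>j\<in>J. measure \<kappa> (D j) \<in> A j}"
          using J(2) by auto
        have e2: "(\<lambda>\<kappa>. measure \<kappa> (D j)) -` A j \<inter> space (poisson_mixture \<mu>) =
          {\<kappa> \<in> configurations. measure \<kappa> (D j) \<in> A j}" for j by auto
        show "prob (\<Inter>j\<in>J. (\<lambda>\<kappa>. measure \<kappa> (D j)) -` A j \<inter> space (poisson_mixture \<mu>)) =
        (\<Prod>j\<in>J. prob ((\<lambda>\<kappa>. measure \<kappa> (D j)) -` A j \<inter> space (poisson_mixture \<mu>)))"
          unfolding e1 unfolding e2 using count[OF J(1) D disj cov, of A] single[OF D] by simp
      qed
    qed (use J in \<open>auto simp: Int_stable_def sets.sigma_sets_eq[of borel, simplified]\<close>)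
    then have "indep_vars (\<lambda>_. borel) (\<lambda>i \<kappa>. measure \<kappa> (D i)) I"
      by (rule indep_vars_subset) (auto simp: J_def)
    then show "indep_vars (\<lambda>_. borel) (\<lambda>i \<kappa>. measure \<kappa> (B i)) I"
      by (rule indep_vars_cong[THEN iffD1, rotated -1]) (auto simp: DI)
  qed
qed

section \<open>Uniqueness of the Poisson law\<close>
lemma poisson_process_count_law:
  assumes P: "sets P = sets configuration_space" "poisson_process P (\<lambda>\<kappa>. \<kappa>) \<mu>" 
    and Q: "sets Q = sets configuration_space" "poisson_process Q (\<lambda>\<kappa>. \<kappa>) \<mu>"
    and B: "B \<in> sets borel"
  shows "distr P borel (\<lambda>\<kappa>. measure \<kappa> B) = distr Q borel (\<lambda>\<kappa>. measure \<kappa> B)"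
proof -
  have 1: "emeasure (distr R borel (\<lambda>\<kappa>. measure \<kappa> B)) A =
     (\<integral>\<^sup>+k. ennreal (measure \<mu> B ^ k / fact k * exp (- measure \<mu> B)) \<partial>count_space {k::nat. real k \<in> A})"
    if R: "sets R = sets configuration_space" "poisson_process R (\<lambda>\<kappa>. \<kappa>) \<mu>" and A: "A \<in> sets borel" for R A
  proof -
    interpret prob_space R using R by (simp add: poisson_process_def)
    have sp: "space R = configurations" using sets_eq_imp_space_eq[OF R(1)] by simp
    have m: "(\<lambda>\<kappa>. measure \<kappa> B) \<in> borel_measurable R"
      using measurable_count_borel[OF B] R(1) by (simp cong: measurable_cong_sets)
    have "emeasure (distr R borel (\<lambda>\<kappa>. measure \<kappa> B)) A = emeasure R ((\<lambda>\<kappa>. measure \<kappa> B) -` A \<inter> space R)"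
      by (rule emeasure_distr[OF m A])
    also have "(\<lambda>\<kappa>. measure \<kappa> B) -` A \<inter> space R = (\<Union>k\<in>{k::nat. real k \<in> A}. {\<kappa>\<in>space R. measure \<kappa> B = real k})"
      using B by (auto simp: sp) (metis configuration_count_nat)
    also have "emeasure R \<dots> = (\<integral>\<^sup>+k. emeasure R {\<kappa>\<in>space R. measure \<kappa> B = real k} \<partial>count_space {k::nat. real k \<in> A})"
    proof (rule emeasure_UN_countable)
      show "{\<kappa> \<in> space R. measure \<kappa> B = real k} \<in> events" for k using m by measurable
    qed (auto simp: disjoint_family_on_def)
    also have "\<dots> = (\<integral>\<^sup>+k. ennreal (measure \<mu> B ^ k / fact k * exp (- measure \<mu> B)) \<partial>count_space {k::nat. real k \<in> A})"
      using R(2) B by (auto simp: poisson_process_def emeasure_eq_measure)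
    finally show ?thesis .
  qed
  show ?thesis
    by (rule measure_eqI) (auto simp: 1[OF P] 1[OF Q])
qed

text \<open>The sets \<open>B i\<close> may overlap. They are unions of the atoms \<open>D j\<close> of the algebra they generate, and
  the joint law of the counts on the atoms is determined by independence and the marginal laws. An
  atom is given by the set of those \<open>i\<close> for which it lies in \<open>B i\<close>; \<open>set_encode\<close> turns these
  sets into the natural numbers by which a Poisson process indexes disjoint families.\<close>
lemma poisson_process_count_events_eq:
  fixes R Q :: "'a::t2_space measure measure"
  assumes R: "sets R = sets configuration_space" "poisson_process R (\<lambda>\<kappa>. \<kappa>) \<mu>"
    and Q: "sets Q = sets configuration_space" "poisson_process Q (\<lambda>\<kappa>. \<kappa>) \<mu>"
    and I: "finite I" "\<And>i. i \<in> I \<Longrightarrow> B i \<in> sets borel" "\<And>i. i \<in> I \<Longrightarrow> A i \<in> sets borel"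
  shows "emeasure R {\<kappa> \<in> configurations. \<forall>i\<in>I. measure \<kappa> (B i) \<in> A i} =
         emeasure Q {\<kappa> \<in> configurations. \<forall>i\<in>(I::nat set). measure \<kappa> (B i) \<in> A i}"
proof -
  define J where "J = set_encode ` Pow I"
  define D where "D j = {x. \<forall>i\<in>I. x \<in> B i \<longleftrightarrow> i \<in> set_decode j}" for j
  have J: "finite J" "J \<noteq> {}" using I(1) by (auto simp: J_def)
  have decode: "set_decode (set_encode T) = T" if "T \<subseteq> I" for T
    using that I(1) by (intro set_encode_inverse) (auto intro: finite_subset)
  have Dm: "D j \<in> sets borel" for j
  proof -
    have "D j = (\<Inter>i\<in>I. if i \<in> set_decode j then B i else - B i)"
      by (auto simp: D_def split: if_splits)
    also have "\<dots> \<in> sets borel"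
    proof (cases "I = {}")
      case False
      with I(1,2) show ?thesis by (intro sets.finite_INT) auto
    qed simp
    finally show ?thesis .
  qed
  have sub: "set_decode j \<subseteq> I" if "j \<in> J" for j using that decode by (auto simp: J_def)
  have disj: "disjoint_family_on D J"
    unfolding disjoint_family_on_def
  proof (intro ballI impI)
    fix j l assume jl: "j \<in> J" "l \<in> J" "j \<noteq> l"
    then have "set_decode j \<noteq> set_decode l" using decode by (auto simp: J_def)
    then obtain i where "i \<in> I" "i \<in> set_decode j \<longleftrightarrow> i \<notin> set_decode l" using sub jl by blast
    then show "D j \<inter> D l = {}" by (auto simp: D_def)
  qed
  have union: "B i = (\<Union>j\<in>{j\<in>J. i \<in> set_decode j}. D j)" if i: "i \<in> I" for i
  proof (intro equalityI subsetI)
    fix x assume x: "x \<in> B i"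
    let ?T = "{i\<in>I. x \<in> B i}"
    have "set_encode ?T \<in> {j\<in>J. i \<in> set_decode j}" "x \<in> D (set_encode ?T)"
      using x i decode[of ?T] by (auto simp: J_def D_def)
    then show "x \<in> (\<Union>j\<in>{j\<in>J. i \<in> set_decode j}. D j)" by blast
  qed (use i in \<open>auto simp: D_def\<close>)
  define Z where "Z = {y \<in> space (PiM J (\<lambda>_. borel)). \<forall>i\<in>I. (\<Sum>j\<in>{j\<in>J. i \<in> set_decode j}. y j) \<in> A i}"
  have Z: "Z \<in> sets (PiM J (\<lambda>_. borel :: real measure))"
  proof -
    have "{y \<in> space (PiM J (\<lambda>_. borel)). (\<Sum>j\<in>{j\<in>J. i \<in> set_decode j}. y j) \<in> A i} \<in> sets (PiM J (\<lambda>_. borel :: real measure))"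
      if "i \<in> I" for i
    proof -
      have "(\<lambda>y. (\<Sum>j\<in>{j\<in>J. i \<in> set_decode j}. y j)) \<in> borel_measurable (PiM J (\<lambda>_. borel :: real measure))"
        by (intro borel_measurable_sum measurable_component_singleton) auto
      from measurable_sets[OF this I(3)[OF that]] show ?thesis
        by (simp add: vimage_def Int_def conj_commute)
    qed
    then show ?thesis unfolding Z_def using I(1) by (intro sets.sets_Collect_finite_All) auto
  qed
  let ?X = "\<lambda>\<kappa>. \<lambda>j\<in>J. measure \<kappa> (D j)"
  have ev: "{\<kappa> \<in> configurations. \<forall>i\<in>I. measure \<kappa> (B i) \<in> A i} = ?X -` Z \<inter> configurations"
  proof -
    have "(\<Sum>j\<in>{j\<in>J. i \<in> set_decode j}. ?X \<kappa> j) = measure \<kappa> (B i)" if "\<kappa> \<in> configurations" "i \<in> I" for i \<kappa>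
    proof -
      interpret finite_measure \<kappa> using that by (auto simp: configurations_def finite_measures_def)
      have "sets \<kappa> = sets borel" using that by (auto simp: configurations_def finite_measures_def)
      then have "measure \<kappa> (\<Union>j\<in>{j\<in>J. i \<in> set_decode j}. D j) = (\<Sum>j\<in>{j\<in>J. i \<in> set_decode j}. measure \<kappa> (D j))"
        using J(1) Dm disj by (intro finite_measure_finite_Union) (auto simp: disjoint_family_on_def)
      then show ?thesis using union[OF that(2)] by simp
    qed
    then show ?thesis by (auto simp: Z_def space_PiM)
  qed
  have law: "emeasure R' (?X -` Z \<inter> configurations) = emeasure (PiM J (\<lambda>j. distr R' borel (\<lambda>\<kappa>. measure \<kappa> (D j)))) Z"
    if R': "sets R' = sets configuration_space" "poisson_process R' (\<lambda>\<kappa>. \<kappa>) \<mu>" for R'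
  proof -
    interpret prob_space R' using R' by (simp add: poisson_process_def)
    have sp: "space R' = configurations" using sets_eq_imp_space_eq[OF R'(1)] by simp
    have m: "(\<lambda>\<kappa>. measure \<kappa> (D j)) \<in> borel_measurable R'" for j
      using measurable_count_borel[OF Dm] R'(1) by (simp cong: measurable_cong_sets)
    have "indep_vars (\<lambda>_. borel) (\<lambda>j \<kappa>. measure \<kappa> (D j)) J"
    proof -
      have "indep_vars (\<lambda>_. borel) (\<lambda>i \<kappa>. measure \<kappa> (F i)) K"
        if "finite K" "F ` K \<subseteq> sets borel" "disjoint_family_on F K" for F :: "nat \<Rightarrow> 'a set" and K
        using R'(2) that unfolding poisson_process_def by blast
      from this[OF J(1) _ disj] Dm show ?thesis by auto
    qed
    then have "distr R' (PiM J (\<lambda>_. borel)) ?X = PiM J (\<lambda>j. distr R' borel (\<lambda>\<kappa>. measure \<kappa> (D j)))"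
      using indep_vars_iff_distr_eq_PiM[where I=J and X="\<lambda>j \<kappa>. measure \<kappa> (D j)" and M'="\<lambda>_. borel"] J m by simp
    moreover have "emeasure R' (?X -` Z \<inter> configurations) = emeasure (distr R' (PiM J (\<lambda>_. borel)) ?X) Z"
      using m Z unfolding sp[symmetric] by (intro emeasure_distr[symmetric] measurable_restrict) auto
    ultimately show ?thesis by simp
  qed
  show ?thesis
    unfolding ev law[OF R] law[OF Q] using poisson_process_count_law[OF R Q Dm] by simp
qed

text \<open>The events about finitely many counts form a generating \<open>\<pi>\<close>-system of the configuration space.\<close>
lemma poisson_process_unique:
  fixes R Q :: "'a::t2_space measure measure"
  assumes R: "sets R = sets configuration_space" "poisson_process R (\<lambda>\<kappa>. \<kappa>) \<mu>"
    and Q: "sets Q = sets configuration_space" "poisson_process Q (\<lambda>\<kappa>. \<kappa>) \<mu>"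
  shows "R = Q"
proof -
  let ?E = "{{\<kappa> \<in> configurations. \<forall>i\<in>I. measure \<kappa> (B i) \<in> A i} | (I::nat set) (B::nat \<Rightarrow> 'a set) A. 
     finite I \<and> (\<forall>i\<in>I. B i \<in> sets borel) \<and> (\<forall>i\<in>I. A i \<in> sets borel)}"
  let ?G = "{{\<kappa> \<in> configurations. measure \<kappa> B \<in> A} | A (B::'a set). A \<in> sets borel \<and> B \<in> sets borel}"
  have E: "?E \<subseteq> sets configuration_space"
  proof
    fix Z assume "Z \<in> ?E"
    then obtain I :: "nat set" and B :: "nat \<Rightarrow> 'a set" and A where Z: "Z = {\<kappa> \<in> configurations. \<forall>i\<in>I. measure \<kappa> (B i) \<in> A i}"
      and I: "finite I" "\<And>i. i \<in> I \<Longrightarrow> B i \<in> sets borel" "\<And>i. i \<in> I \<Longrightarrow> A i \<in> sets borel" by auto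
    have "{\<kappa> \<in> space configuration_space. measure \<kappa> (B i) \<in> A i} \<in> sets configuration_space" if "i \<in> I" for i
      using measurable_sets[OF measurable_count_borel[OF I(2)[OF that]] I(3)[OF that]] by (simp add: vimage_def Int_def conj_commute)
    then have "{\<kappa> \<in> space configuration_space. \<forall>i\<in>I. measure \<kappa> (B i) \<in> A i} \<in> sets configuration_space"
      using I(1) by (intro sets.sets_Collect_finite_All) auto
    then show "Z \<in> sets configuration_space" by (simp add: Z)
  qed
  have gen: "sets configuration_space = sigma_sets configurations ?E"
  proof (rule antisym)
    have "?G \<subseteq> ?E"
    proof
      fix Z assume "Z \<in> ?G"
      then obtain A B where "Z = {\<kappa> \<in> configurations. measure \<kappa> B \<in> A}" "A \<in> sets borel" "B \<in> sets borel" by auto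
      then show "Z \<in> ?E" 
        by (intro CollectI exI[of _ "{0::nat}"] exI[of _ "\<lambda>_. B"] exI[of _ "\<lambda>_. A"]) auto
    qed
    then show "sets configuration_space \<subseteq> sigma_sets configurations ?E"
      unfolding configuration_space_eq sets_config_space_on by (rule sigma_sets_mono')
    show "sigma_sets configurations ?E \<subseteq> sets configuration_space"
      using sets.sigma_sets_subset[OF E] by simp
  qed
  have pR: "prob_space R" using R by (simp add: poisson_process_def)
  have top: "configurations \<in> ?E"
    by (rule CollectI, rule exI[of _ "{}"]) auto
  show ?thesis
  proof (rule measure_eqI_generator_eq[where \<Omega>=configurations and E="?E" and A="\<lambda>_. configurations"])
    show "Int_stable ?E"
    proof (rule Int_stableI)
      fix a b assume "a \<in> ?E" "b \<in> ?E"
      then obtain I J :: "nat set" and B C :: "nat \<Rightarrow> 'a set" and A F where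
        a: "a = {\<kappa> \<in> configurations. \<forall>i\<in>I. measure \<kappa> (B i) \<in> A i}" and
        b: "b = {\<kappa> \<in> configurations. \<forall>i\<in>J. measure \<kappa> (C i) \<in> F i}" and
        fin: "finite I" "\<forall>i\<in>I. B i \<in> sets borel" "\<forall>i\<in>I. A i \<in> sets borel"
         "finite J" "\<forall>i\<in>J. C i \<in> sets borel" "\<forall>i\<in>J. F i \<in> sets borel"
        by clarify blast
      (* Even indices carry the conditions of a, odd ones those of b. *)
      let ?K = "(\<lambda>i. 2 * i) ` I \<union> (\<lambda>i. 2 * i + 1) ` J"
      let ?B = "\<lambda>k. if even k then B (k div 2) else C (k div 2)"
      let ?A = "\<lambda>k. if even k then A (k div 2) else F (k div 2)"
      have "a \<inter> b = {\<kappa> \<in> configurations. \<forall>i\<in>?K. measure \<kappa> (?B i) \<in> ?A i}"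
        unfolding a b ball_Un ball_simps by auto
      moreover have "finite ?K" "\<forall>i\<in>?K. ?B i \<in> sets borel" "\<forall>i\<in>?K. ?A i \<in> sets borel"
        using fin by auto
      ultimately show "a \<inter> b \<in> ?E"
        by (intro CollectI exI[of _ ?K] exI[of _ ?B] exI[of _ ?A]) (intro conjI)
    qed
    show "sets R = sigma_sets configurations ?E" "sets Q = sigma_sets configurations ?E"
      using R(1) Q(1) gen by simp_all
    show "range (\<lambda>_::nat. configurations) \<subseteq> ?E" using top by blast
    fix X assume "X \<in> ?E"
    then show "emeasure R X = emeasure Q X"
      using poisson_process_count_events_eq[OF R Q] by auto
  next
    show "emeasure R configurations \<noteq> \<infinity>" 
      using prob_space.emeasure_space_1[OF pR] sets_eq_imp_space_eq[OF R(1)] by simp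
  qed auto
qed

lemma poisson_law_eq:
  assumes "\<mu> \<in> finite_measures"
  shows "poisson_law \<mu> = poisson_mixture \<mu>"
  unfolding poisson_law_def
  using poisson_process_poisson_mixture[OF assms] sets_poisson_mixture
  by (intro the_equality) (auto intro: poisson_process_unique)

section \<open>Tests and exponential separability\<close>
lemma prob_space_poisson_law: "\<mu> \<in> finite_measures \<Longrightarrow> prob_space (poisson_law \<mu>)"
  by (simp add: poisson_law_eq prob_space_poisson_mixture)

lemma sets_poisson_law: "\<mu> \<in> finite_measures \<Longrightarrow> sets (poisson_law \<mu>) = sets configuration_space"
  by (simp add: poisson_law_eq)

lemma sets_PiM_poisson_law:
  "\<mu> \<in> finite_measures \<Longrightarrow> sets (PiM I (\<lambda>_. poisson_law \<mu>)) = sets (PiM I (\<lambda>_. configuration_space))"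
  by (intro sets_PiM_cong) (auto simp: sets_poisson_law)

lemma space_PiM_poisson_law:
  "\<mu> \<in> finite_measures \<Longrightarrow> space (PiM I (\<lambda>_. poisson_law \<mu>)) = space (PiM I (\<lambda>_. configuration_space))"
  by (intro sets_eq_imp_space_eq sets_PiM_poisson_law)

lemma prob_space_PiM_poisson_law:
  "\<mu> \<in> finite_measures \<Longrightarrow> prob_space (PiM I (\<lambda>_. poisson_law \<mu>))"
  by (intro prob_space_PiM prob_space_poisson_law)

lemma is_test_borel:
  assumes "is_test n K" "\<mu> \<in> finite_measures"
  shows "K \<in> borel_measurable (PiM {1..n} (\<lambda>_. poisson_law \<mu>))"
  using assms(1) unfolding is_test_def measurable_cong_sets[OF sets_PiM_poisson_law[OF assms(2)] refl] by blast

lemma is_test_bounds: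
  assumes "is_test n K" "\<mu> \<in> finite_measures" "\<kappa> \<in> space (PiM {1..n} (\<lambda>_. poisson_law \<mu>))"
  shows "0 \<le> K \<kappa>" "K \<kappa> \<le> 1"
  using assms space_PiM_poisson_law[OF assms(2)] by (auto simp: is_test_def)

lemma is_test_integrable:
  assumes "is_test n K" "\<mu> \<in> finite_measures"
  shows "integrable (PiM {1..n} (\<lambda>_. poisson_law \<mu>)) K"
proof -
  interpret prob_space "PiM {1..n} (\<lambda>_. poisson_law \<mu>)" by (rule prob_space_PiM_poisson_law[OF assms(2)])
  show ?thesis
    using is_test_bounds[OF assms] by (intro integrable_const_bound[of _ 1] AE_I2 is_test_borel[OF assms]) auto
qed

lemma expectation_under_compl:
  assumes "is_test n K" "\<mu> \<in> finite_measures"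
  shows "expectation_under n \<mu> (\<lambda>\<kappa>. 1 - K \<kappa>) = 1 - expectation_under n \<mu> K"
proof -
  interpret prob_space "PiM {1..n} (\<lambda>_. poisson_law \<mu>)" by (rule prob_space_PiM_poisson_law[OF assms(2)])
  show ?thesis
    unfolding expectation_under_def using is_test_integrable[OF assms] by (simp add: prob_space del: One_nat_def)
qed

lemma expectation_under_mono:
  assumes "is_test n K" "is_test n L" "\<mu> \<in> finite_measures"
    and "\<And>\<kappa>. \<kappa> \<in> space (PiM {1..n} (\<lambda>_. configuration_space)) \<Longrightarrow> K \<kappa> \<le> L \<kappa>"
  shows "expectation_under n \<mu> K \<le> expectation_under n \<mu> L"
  unfolding expectation_under_def
  using assms by (intro integral_mono is_test_integrable) (auto simp: space_PiM_poisson_law)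

lemma is_test_compl: "is_test n K \<Longrightarrow> is_test n (\<lambda>\<kappa>. 1 - K \<kappa>)"
  by (auto simp: is_test_def)

lemma is_test_mult:
  "is_test n K \<Longrightarrow> is_test n L \<Longrightarrow> is_test n (\<lambda>\<kappa>. K \<kappa> * L \<kappa>)"
  by (auto simp: is_test_def intro: mult_le_one)

text \<open>An error of the second kind for \<open>K\<close> is an error of the first kind for \<open>1 - K\<close>. This makes
  exchanging the roles of the hypotheses a formality.\<close>
lemma beta_error_eq_alpha_error: "beta_error \<Theta> n K = alpha_error \<Theta> n (\<lambda>\<kappa>. 1 - K \<kappa>)"
  by (simp add: alpha_error_def beta_error_def)

lemma alpha_error_le_iff:
  "0 \<le> r \<Longrightarrow> alpha_error \<Theta> n K \<le> ennreal r \<longleftrightarrow> (\<forall>\<mu>\<in>\<Theta>. expectation_under n \<mu> K \<le> r)"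
  by (simp add: alpha_error_def SUP_le_iff ennreal_le_iff)

definition exp_separable :: "'a::t2_space measure set \<Rightarrow> 'a measure set \<Rightarrow> bool" where
  "exp_separable A B \<longleftrightarrow> (\<exists>K c n0. (\<forall>n\<ge>1. is_test n (K n)) \<and> c > 0 \<and>
     (\<forall>n>n0. alpha_error A n (K n) \<le> ennreal (exp (- c * real n)) \<and>
             beta_error B n (K n) \<le> ennreal (exp (- c * real n))))"

lemma exp_separableI:
  fixes A B :: "'a::t2_space measure set"
  assumes "\<And>n. n \<ge> 1 \<Longrightarrow> is_test n (K n)" "c > 0"
    and "\<And>n \<mu>. n > N \<Longrightarrow> \<mu> \<in> A \<Longrightarrow> expectation_under n \<mu> (K n) \<le> exp (- c * real n)"
    and "\<And>n \<mu>. n > N \<Longrightarrow> \<mu> \<in> B \<Longrightarrow> expectation_under n \<mu> (\<lambda>\<kappa>. 1 - K n \<kappa>) \<le> exp (- c * real n)"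
  shows "exp_separable A B"
  unfolding exp_separable_def beta_error_eq_alpha_error using assms
  by (intro exI[of _ K] exI[of _ c] exI[of _ N]) (auto simp: alpha_error_le_iff)

lemma exp_separableE:
  assumes "exp_separable A B"
  obtains K c n0 where "\<And>n. n \<ge> 1 \<Longrightarrow> is_test n (K n)" "c > 0"
    "\<And>n \<mu>. n > n0 \<Longrightarrow> \<mu> \<in> A \<Longrightarrow> expectation_under n \<mu> (K n) \<le> exp (- c * real n)"
    "\<And>n \<mu>. n > n0 \<Longrightarrow> \<mu> \<in> B \<Longrightarrow> expectation_under n \<mu> (\<lambda>\<kappa>. 1 - K n \<kappa>) \<le> exp (- c * real n)"
proof -
  obtain K c n0 where *: "\<forall>n\<ge>1. is_test n (K n)" "c > 0"
    "\<forall>n>n0. alpha_error A n (K n) \<le> ennreal (exp (- c * real n)) \<and>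
             beta_error B n (K n) \<le> ennreal (exp (- c * real n))"
    using assms unfolding exp_separable_def by blast
  show ?thesis
    by (rule that[of K c n0]) (use * in \<open>auto simp: beta_error_eq_alpha_error alpha_error_le_iff\<close>)
qed

lemma exp_separable_sym:
  assumes "exp_separable A B"
  shows "exp_separable B A"
proof -
  obtain K c n0 where *: "\<And>n. n \<ge> 1 \<Longrightarrow> is_test n (K n)" "c > 0"
    "\<And>n \<mu>. n > n0 \<Longrightarrow> \<mu> \<in> A \<Longrightarrow> expectation_under n \<mu> (K n) \<le> exp (- c * real n)"
    "\<And>n \<mu>. n > n0 \<Longrightarrow> \<mu> \<in> B \<Longrightarrow> expectation_under n \<mu> (\<lambda>\<kappa>. 1 - K n \<kappa>) \<le> exp (- c * real n)"
    using assms by (rule exp_separableE) blast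
  show ?thesis
    by (rule exp_separableI[where K="\<lambda>n \<kappa>. 1 - K n \<kappa>" and c=c and N=n0]) (use * in \<open>auto intro: is_test_compl\<close>)
qed

lemma exp_separable_mono:
  assumes "exp_separable A B" "A' \<subseteq> A" "B' \<subseteq> B"
  shows "exp_separable A' B'"
proof -
  obtain K c n0 where *: "\<And>n. n \<ge> 1 \<Longrightarrow> is_test n (K n)" "c > 0"
    "\<And>n \<mu>. n > n0 \<Longrightarrow> \<mu> \<in> A \<Longrightarrow> expectation_under n \<mu> (K n) \<le> exp (- c * real n)"
    "\<And>n \<mu>. n > n0 \<Longrightarrow> \<mu> \<in> B \<Longrightarrow> expectation_under n \<mu> (\<lambda>\<kappa>. 1 - K n \<kappa>) \<le> exp (- c * real n)"
    using assms(1) by (rule exp_separableE) blast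
  show ?thesis
    by (rule exp_separableI[where K=K and c=c and N=n0]) (use * assms(2,3) in auto)
qed

lemma exp_separable_empty: "exp_separable {} (B :: 'a::t2_space measure set)"
  by (rule exp_separableI[where K="\<lambda>_ _. 1" and c=1]) (auto simp: is_test_def expectation_under_def)

text \<open>The product of the two tests rejects only if both do, so its first error is small on each part
  of the union. Its second error is at most the sum of the two second errors; the factor 2 is absorbed
  by halving the exponent.\<close>
lemma exp_separable_Un_left:
  assumes fin: "A1 \<subseteq> finite_measures" "A2 \<subseteq> finite_measures" "B \<subseteq> finite_measures"
    and "exp_separable A1 B" "exp_separable A2 B"
  shows "exp_separable (A1 \<union> A2) B"
proof -
  obtain K1 c1 n1 where 1: "\<And>n. n \<ge> 1 \<Longrightarrow> is_test n (K1 n)" "c1 > 0"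
    "\<And>n \<mu>. n > n1 \<Longrightarrow> \<mu> \<in> A1 \<Longrightarrow> expectation_under n \<mu> (K1 n) \<le> exp (- c1 * real n)"
    "\<And>n \<mu>. n > n1 \<Longrightarrow> \<mu> \<in> B \<Longrightarrow> expectation_under n \<mu> (\<lambda>\<kappa>. 1 - K1 n \<kappa>) \<le> exp (- c1 * real n)"
    using assms(4) by (rule exp_separableE) blast
  obtain K2 c2 n2 where 2: "\<And>n. n \<ge> 1 \<Longrightarrow> is_test n (K2 n)" "c2 > 0"
    "\<And>n \<mu>. n > n2 \<Longrightarrow> \<mu> \<in> A2 \<Longrightarrow> expectation_under n \<mu> (K2 n) \<le> exp (- c2 * real n)"
    "\<And>n \<mu>. n > n2 \<Longrightarrow> \<mu> \<in> B \<Longrightarrow> expectation_under n \<mu> (\<lambda>\<kappa>. 1 - K2 n \<kappa>) \<le> exp (- c2 * real n)"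
    using assms(5) by (rule exp_separableE) blast
  define c where "c = min c1 c2 / 2"
  have c: "c > 0" "2 * c \<le> c1" "2 * c \<le> c2" using 1(2) 2(2) by (auto simp: c_def)
  (* From ln 2 / c onwards, 2 * exp (- 2 * c * n) is at most exp (- c * n). *)
  define n0 where "n0 = max (max n1 n2) (nat \<lceil>ln 2 / c\<rceil>)"
  have large: "1 \<le> n" "n > n1" "n > n2" "2 * exp (- (2 * c) * real n) \<le> exp (- c * real n)" if "n > n0" for n
  proof -
    show "1 \<le> n" "n > n1" "n > n2" using that by (auto simp: n0_def)
    have "nat \<lceil>ln 2 / c\<rceil> \<le> n" using that unfolding n0_def by linarith
    then have "ln 2 / c \<le> real n" using real_nat_ceiling_ge[of "ln 2 / c"] by linarith
    then have "ln 2 \<le> c * real n" using c(1) by (simp add: field_simps)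
    then have "exp (ln 2 - 2 * c * real n) \<le> exp (- c * real n)" by simp
    moreover have "exp (ln 2 - 2 * c * real n) = 2 * exp (- (2 * c) * real n)"
      by (simp add: exp_diff exp_minus field_simps)
    ultimately show "2 * exp (- (2 * c) * real n) \<le> exp (- c * real n)" by simp
  qed
  have e1: "exp (- c1 * real n) \<le> exp (- (2 * c) * real n)" "exp (- c2 * real n) \<le> exp (- (2 * c) * real n)" for n
    using c by (auto intro!: mult_right_mono)
  let ?K = "\<lambda>n \<kappa>. K1 n \<kappa> * K2 n \<kappa>"
  show ?thesis
  proof (rule exp_separableI[where K="?K" and c=c and N=n0])
    show "is_test n (?K n)" if "n \<ge> 1" for n using 1(1) 2(1) that by (intro is_test_mult)
    show "c > 0" by fact
  next
    fix n \<mu> assume n: "n > n0" and \<mu>: "\<mu> \<in> A1 \<union> A2"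
    note n' = large[OF n]
    have t: "is_test n (K1 n)" "is_test n (K2 n)" "is_test n (?K n)"
      using 1(1) 2(1) n'(1) by (auto intro: is_test_mult)
    have bd: "0 \<le> K1 n \<kappa> \<and> K1 n \<kappa> \<le> 1 \<and> 0 \<le> K2 n \<kappa> \<and> K2 n \<kappa> \<le> 1"
      if "\<kappa> \<in> space (PiM {1..n} (\<lambda>_. configuration_space))" for \<kappa>
      using that t by (auto simp: is_test_def)
    have \<mu>f: "\<mu> \<in> finite_measures" using \<mu> fin by auto
    have "expectation_under n \<mu> (?K n) \<le> expectation_under n \<mu> (K1 n)"
      using bd by (intro expectation_under_mono[OF t(3) t(1) \<mu>f] mult_right_le_one_le) auto
    moreover have "expectation_under n \<mu> (?K n) \<le> expectation_under n \<mu> (K2 n)"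
      using bd by (intro expectation_under_mono[OF t(3) t(2) \<mu>f] mult_left_le_one_le) auto
    ultimately have "expectation_under n \<mu> (?K n) \<le> exp (- (2 * c) * real n)"
      using 1(3)[OF n'(2)] 2(3)[OF n'(3)] \<mu> e1[of n] by (meson UnE order_trans)
    then show "expectation_under n \<mu> (?K n) \<le> exp (- c * real n)"
      using n'(4) exp_gt_zero[of "- (2 * c) * real n"] by linarith
  next
    fix n \<mu> assume n: "n > n0" and \<mu>: "\<mu> \<in> B"
    note n' = large[OF n]
    have t: "is_test n (K1 n)" "is_test n (K2 n)" "is_test n (?K n)"
      using 1(1) 2(1) n'(1) by (auto intro: is_test_mult)
    have bd: "0 \<le> K1 n \<kappa> \<and> K1 n \<kappa> \<le> 1 \<and> 0 \<le> K2 n \<kappa> \<and> K2 n \<kappa> \<le> 1"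
      if "\<kappa> \<in> space (PiM {1..n} (\<lambda>_. configuration_space))" for \<kappa>
      using that t by (auto simp: is_test_def)
    have \<mu>f: "\<mu> \<in> finite_measures" using \<mu> fin by auto
    have "1 - K1 n \<kappa> * K2 n \<kappa> \<le> (1 - K1 n \<kappa>) + (1 - K2 n \<kappa>)"
      if "\<kappa> \<in> space (PiM {1..n} (\<lambda>_. configuration_space))" for \<kappa>
      using mult_nonneg_nonneg[of "1 - K1 n \<kappa>" "1 - K2 n \<kappa>"] bd[OF that] by (simp add: algebra_simps)
    then have "expectation_under n \<mu> (\<lambda>\<kappa>. 1 - ?K n \<kappa>) \<le>
        (\<integral>\<kappa>. (1 - K1 n \<kappa>) + (1 - K2 n \<kappa>) \<partial>PiM {1..n} (\<lambda>_. poisson_law \<mu>))"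
      unfolding expectation_under_def using t \<mu>f
      by (intro integral_mono is_test_integrable is_test_compl Bochner_Integration.integrable_add)
         (auto simp: space_PiM_poisson_law)
    also have "\<dots> = expectation_under n \<mu> (\<lambda>\<kappa>. 1 - K1 n \<kappa>) + expectation_under n \<mu> (\<lambda>\<kappa>. 1 - K2 n \<kappa>)"
      unfolding expectation_under_def using t \<mu>f
      by (intro Bochner_Integration.integral_add is_test_integrable is_test_compl)
    also have "\<dots> \<le> exp (- (2 * c) * real n) + exp (- (2 * c) * real n)"
      using 1(4)[OF n'(2) \<mu>] 2(4)[OF n'(3) \<mu>] e1[of n] by linarith
    finally show "expectation_under n \<mu> (\<lambda>\<kappa>. 1 - ?K n \<kappa>) \<le> exp (- c * real n)"
      using n'(4) by linarith
  qed
qed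

lemma exp_separable_UN_left:
  assumes "finite I" "\<And>i. i \<in> I \<Longrightarrow> A i \<subseteq> finite_measures" "B \<subseteq> finite_measures"
    and "\<And>i. i \<in> I \<Longrightarrow> exp_separable (A i) B"
  shows "exp_separable (\<Union>i\<in>I. A i) B"
  using assms(1,2,4)
proof (induction I)
  case empty then show ?case by (simp add: exp_separable_empty)
next
  case (insert i I)
  have "exp_separable (A i \<union> (\<Union>i\<in>I. A i)) B"
    using insert assms(3) by (intro exp_separable_Un_left) auto
  then show ?case by simp
qed

section \<open>Separation by the number of points in one set\<close>
lemma nn_integral_exp_count:
  assumes \<mu>: "\<mu> \<in> finite_measures" and B: "B \<in> sets borel"
  shows "(\<integral>\<^sup>+\<kappa>. ennreal (exp (s * measure \<kappa> B)) \<partial>poisson_law \<mu>) = ennreal (exp (measure \<mu> B * (exp s - 1)))"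
proof -
  interpret prob_space "poisson_law \<mu>" by (rule prob_space_poisson_law[OF \<mu>])
  have sp: "space (poisson_law \<mu>) = configurations"
    using sets_eq_imp_space_eq[OF sets_poisson_law[OF \<mu>]] by simp
  have m: "(\<lambda>\<kappa>. measure \<kappa> B) \<in> borel_measurable (poisson_law \<mu>)"
    using measurable_count_borel[OF B] by (simp add: sets_poisson_law[OF \<mu>] cong: measurable_cong_sets)
  let ?E = "\<lambda>k. {\<kappa> \<in> space (poisson_law \<mu>). measure \<kappa> B = real k}"
  have E: "?E k \<in> sets (poisson_law \<mu>)" for k using m by measurable
  have P: "emeasure (poisson_law \<mu>) (?E k) = ennreal (measure \<mu> B ^ k / fact k * exp (- measure \<mu> B))" for k
    using poisson_process_poisson_mixture[OF \<mu>] B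
    unfolding emeasure_eq_measure unfolding poisson_law_eq[OF \<mu>] poisson_process_def by simp
  have "(\<integral>\<^sup>+\<kappa>. ennreal (exp (s * measure \<kappa> B)) \<partial>poisson_law \<mu>) =
    (\<integral>\<^sup>+\<kappa>. (\<Sum>k. ennreal (exp (s * real k)) * indicator (?E k) \<kappa>) \<partial>poisson_law \<mu>)"
  proof (rule nn_integral_cong)
    fix \<kappa> :: "'a measure" assume \<kappa>: "\<kappa> \<in> space (poisson_law \<mu>)"
    obtain k where k: "measure \<kappa> B = real k"
      by (rule configuration_count_nat[OF _ B]) (use \<kappa> sp in auto)
    have "(\<Sum>i. ennreal (exp (s * real i)) * indicator (?E i) \<kappa>) = (\<Sum>i\<in>{k}. ennreal (exp (s * real i)) * indicator (?E i) \<kappa>)"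
      using k by (intro suminf_finite) auto
    then show "ennreal (exp (s * measure \<kappa> B)) = (\<Sum>i. ennreal (exp (s * real i)) * indicator (?E i) \<kappa>)"
      using k \<kappa> by simp
  qed
  also have "\<dots> = (\<Sum>k. \<integral>\<^sup>+\<kappa>. ennreal (exp (s * real k)) * indicator (?E k) \<kappa> \<partial>poisson_law \<mu>)"
    using E by (intro nn_integral_suminf) auto
  also have "\<dots> = (\<Sum>k. ennreal (exp (- measure \<mu> B) * ((measure \<mu> B * exp s) ^ k /\<^sub>R fact k)))"
    using E by (simp add: nn_integral_cmult_indicator P ennreal_mult'[symmetric] power_mult_distrib exp_of_nat_mult[symmetric] field_simps)
  also have "\<dots> = ennreal (exp (- measure \<mu> B) * exp (measure \<mu> B * exp s))"
    by (intro suminf_ennreal_eq sums_mult exp_converges) auto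
  finally show ?thesis by (simp add: exp_add[symmetric] algebra_simps)
qed

text \<open>Chernoff's bound: Markov's inequality for \<open>exp (s * S)\<close>, where \<open>S\<close> is the total number of points
  in \<open>B\<close>. A positive \<open>s\<close> bounds the upper tail and a negative \<open>s\<close> the lower one.\<close>
lemma chernoff_poisson:
  assumes \<mu>: "\<mu> \<in> finite_measures" and B: "B \<in> sets borel"
  shows "measure (PiM {1..n} (\<lambda>_. poisson_law \<mu>))
      {\<kappa> \<in> space (PiM {1..n} (\<lambda>_. poisson_law \<mu>)). s * (real n * t) \<le> s * (\<Sum>l\<in>{1..n}. measure (\<kappa> l) B)}
    \<le> exp (real n * (measure \<mu> B * (exp s - 1) - s * t))"
proof -
  let ?P = "PiM {1..n} (\<lambda>_. poisson_law \<mu>)"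
  let ?S = "\<lambda>\<kappa>. \<Sum>l\<in>{1..n}. measure (\<kappa> l) B"
  interpret prob_space ?P by (rule prob_space_PiM_poisson_law[OF \<mu>])
  interpret P: product_sigma_finite "\<lambda>_::nat. poisson_law \<mu>"
    using prob_space_poisson_law[OF \<mu>] by (auto simp: product_sigma_finite_def prob_space_def finite_measure_def)
  have m: "(\<lambda>\<kappa>. measure \<kappa> B) \<in> borel_measurable (poisson_law \<mu>)"
    using measurable_count_borel[OF B] by (simp add: sets_poisson_law[OF \<mu>] cong: measurable_cong_sets)
  have mS[measurable]: "?S \<in> borel_measurable ?P"
    by (intro borel_measurable_sum measurable_compose[OF _ m] measurable_component_singleton) auto
  let ?u = "\<lambda>\<kappa>. ennreal (exp (s * ?S \<kappa>))"
  let ?c = "ennreal (exp (- s * (real n * t)))"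
  have set_eq: "{\<kappa> \<in> space ?P. s * (real n * t) \<le> s * ?S \<kappa>} = {\<kappa> \<in> space ?P. 1 \<le> ?c * ?u \<kappa>}"
    by (auto simp: ennreal_mult'[symmetric] exp_add[symmetric])
  have "emeasure ?P {\<kappa> \<in> space ?P. s * (real n * t) \<le> s * ?S \<kappa>} \<le> ?c * (\<integral>\<^sup>+\<kappa>. ?u \<kappa> * indicator (space ?P) \<kappa> \<partial>?P)"
    unfolding set_eq
  proof (rule nn_integral_Markov_inequality)
    show "(\<lambda>\<kappa>. ?u \<kappa> * indicator (space ?P) \<kappa>) \<in> borel_measurable ?P" by measurable
  qed auto
  also have "(\<integral>\<^sup>+\<kappa>. ?u \<kappa> * indicator (space ?P) \<kappa> \<partial>?P) = (\<integral>\<^sup>+\<kappa>. (\<Prod>l\<in>{1..n}. ennreal (exp (s * measure (\<kappa> l) B))) \<partial>?P)"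
    by (intro nn_integral_cong) (simp add: sum_distrib_left exp_sum prod_ennreal)
  also have "\<dots> = (\<Prod>l\<in>{1..n}. ennreal (exp (measure \<mu> B * (exp s - 1))))"
    using m by (subst P.product_nn_integral_prod) (auto simp: nn_integral_exp_count[OF \<mu> B])
  also have "?c * \<dots> = ennreal (exp (real n * (measure \<mu> B * (exp s - 1) - s * t)))"
    by (simp add: ennreal_power ennreal_mult'[symmetric] exp_of_nat_mult[symmetric] exp_add[symmetric] algebra_simps)
  finally show ?thesis
    by (simp add: emeasure_eq_measure del: One_nat_def)
qed

text \<open>The exponent increases with \<open>m\<close> for \<open>s > 0\<close>, so \<open>m = a\<close> is the worst case; there its
  first-order term in \<open>s\<close> is \<open>- s * \<delta>\<close>, which dominates the quadratic one for small \<open>s\<close>.\<close>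
lemma poisson_rate_upper:
  fixes a \<delta> :: real
  assumes "0 \<le> a" "0 < \<delta>"
  obtains s c where "0 < s" "0 < c" "\<And>m. m \<le> a \<Longrightarrow> m * (exp s - 1) - s * (a + \<delta>) \<le> - c"
proof -
  define s where "s = min 1 (\<delta> / (2 * (a + 1)))"
  have s: "0 < s" "s \<le> 1" "s \<le> \<delta> / (2 * (a + 1))" using assms by (auto simp: s_def)
  have "s * (2 * (a + 1)) \<le> \<delta>" using s(3) assms by (simp add: field_simps)
  then have as: "a * s \<le> \<delta> / 2" using s(1) by (simp add: algebra_simps)
  have "m * (exp s - 1) - s * (a + \<delta>) \<le> - (s * \<delta> / 2)" if "m \<le> a" for m
  proof -
    have "m * (exp s - 1) \<le> a * (exp s - 1)" using that s by (intro mult_right_mono) auto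
    also have "\<dots> \<le> a * (s + s\<^sup>2)" using exp_bound[of s] s assms by (intro mult_left_mono) auto
    also have "\<dots> = a * s + s * (a * s)" by (simp add: algebra_simps power2_eq_square)
    also have "\<dots> \<le> a * s + s * (\<delta> / 2)" using as s by (intro add_left_mono mult_left_mono) auto
    finally show ?thesis by (simp add: algebra_simps)
  qed
  moreover have "0 < s * \<delta> / 2" using s assms by simp
  ultimately show ?thesis using that s(1) by blast
qed

text \<open>For negative \<open>s\<close> the exponent decreases with \<open>m\<close>, so \<open>m = t + \<delta>\<close> is the worst case, and the
  bound holds for arbitrarily large \<open>m\<close>. The choice of \<open>s\<close> ensures \<open>t * \<bar>s\<bar> \<le> \<delta> / 2\<close>.\<close>
lemma poisson_rate_lower:
  fixes t \<delta> :: real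
  assumes "0 \<le> t" "0 < \<delta>"
  obtains s c where "s < 0" "0 < c" "\<And>m. t + \<delta> \<le> m \<Longrightarrow> m * (exp s - 1) - s * t \<le> - c"
proof -
  define u where "u = \<delta> / (2 * (t + 1))"
  have u: "0 < u" using assms by (auto simp: u_def)
  have "u * (2 * (t + 1)) = \<delta>" using assms by (simp add: u_def)
  then have tu: "t * u \<le> \<delta> / 2" using u by (simp add: algebra_simps)
  have "m * (exp (- u) - 1) - (- u) * t \<le> - (u * \<delta> / (2 * (1 + u)))" if "t + \<delta> \<le> m" for m
  proof -
    have e: "exp (- u) \<le> 1 / (1 + u)"
      using exp_ge_add_one_self[of u] u by (simp add: exp_minus field_simps)
    then have "exp (- u) - 1 \<le> - u / (1 + u)" using u by (simp add: field_simps)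
    moreover have "m * (exp (- u) - 1) \<le> (t + \<delta>) * (exp (- u) - 1)" 
      using that u by (intro mult_right_mono_neg) auto
    ultimately have "m * (exp (- u) - 1) \<le> (t + \<delta>) * (- u / (1 + u))"
      using assms by (meson add_nonneg_nonneg less_imp_le mult_left_mono order_trans)
    then have "m * (exp (- u) - 1) - (- u) * t \<le> (t + \<delta>) * (- u / (1 + u)) + u * t" by simp
    also have "\<dots> = u * (t * u - \<delta>) / (1 + u)" using u by (simp add: field_simps)
    also have "\<dots> \<le> u * (- \<delta> / 2) / (1 + u)" using tu u by (intro divide_right_mono mult_left_mono) auto
    finally show ?thesis by (simp add: field_simps)
  qed
  moreover have "0 < u * \<delta> / (2 * (1 + u))" using u assms by simp
  ultimately show ?thesis using that[of "- u"] u by auto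
qed

text \<open>The test rejects if the average number of points in \<open>B\<close> is at least the midpoint of \<open>a\<close> and
  \<open>b\<close>. The exponent does not depend on \<open>\<mu>\<close>, although \<open>\<mu> B\<close> is unbounded on the second set.\<close>
lemma exp_separable_count:
  assumes B: "B \<in> sets borel" and ab: "a < (b::real)"
  shows "exp_separable {\<mu> \<in> finite_measures. measure \<mu> B \<le> a} {\<mu> \<in> finite_measures. b \<le> measure \<mu> B}"
proof (cases "0 \<le> a")
  case False
  then have "{\<mu> \<in> finite_measures. measure \<mu> B \<le> a} = {}" by (auto simp: not_le intro: less_le_trans)
  then show ?thesis by (simp only: exp_separable_empty)
next
  case True
  define t where "t = (a + b) / 2"
  define \<delta> where "\<delta> = (b - a) / 2"
  have t: "a + \<delta> = t" "t + \<delta> = b" "0 < \<delta>" "0 \<le> t" using ab True by (auto simp: t_def \<delta>_def field_simps)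
  obtain s c where s: "0 < s" "0 < c" "\<And>m. m \<le> a \<Longrightarrow> m * (exp s - 1) - s * t \<le> - c"
    using poisson_rate_upper[OF True t(3)] t(1) by metis
  obtain s' c' where s': "s' < 0" "0 < c'" "\<And>m. b \<le> m \<Longrightarrow> m * (exp s' - 1) - s' * t \<le> - c'"
    using poisson_rate_lower[OF t(4,3)] t(2) by metis
  let ?S = "\<lambda>n \<kappa>. \<Sum>l\<in>{1..n}. measure (\<kappa> l) B"
  define K where "K n \<kappa> = (if real n * t \<le> ?S n \<kappa> then 1 else 0 :: real)" for n and \<kappa> :: "nat \<Rightarrow> 'a measure"
  have mS: "?S n \<in> borel_measurable (PiM {1..n} (\<lambda>_. configuration_space))" for n
    by (intro borel_measurable_sum measurable_compose[OF _ measurable_count_borel[OF B]] measurable_component_singleton) auto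
  have test: "is_test n (K n)" for n
    unfolding is_test_def K_def[abs_def] using mS[of n] by auto
  define d where "d = min c c'"
  have d: "0 < d" "- c \<le> - d" "- c' \<le> - d" using s s' by (auto simp: d_def)
  have final: "expectation_under n \<mu> F \<le> exp (- d * real n)" 
    if \<mu>: "\<mu> \<in> finite_measures" and F: "is_test n F" 
      and Fle: "\<And>\<kappa>. F \<kappa> \<le> indicator {\<kappa>. r * (real n * t) \<le> r * ?S n \<kappa>} \<kappa>"
      and r: "measure \<mu> B * (exp r - 1) - r * t \<le> - d" for n \<mu> r F
  proof -
    let ?P = "PiM {1..n} (\<lambda>_. poisson_law \<mu>)"
    interpret prob_space ?P by (rule prob_space_PiM_poisson_law[OF \<mu>])
    have E: "{\<kappa> \<in> space ?P. r * (real n * t) \<le> r * ?S n \<kappa>} \<in> sets ?P"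
      using mS[of n] unfolding space_PiM_poisson_law[OF \<mu>] sets_PiM_poisson_law[OF \<mu>] by measurable
    have "expectation_under n \<mu> F \<le> (\<integral>\<kappa>. indicator {\<kappa> \<in> space ?P. r * (real n * t) \<le> r * ?S n \<kappa>} \<kappa> \<partial>?P)"
      unfolding expectation_under_def
    proof (intro integral_mono is_test_integrable[OF F \<mu>])
      show "integrable ?P (indicator {\<kappa> \<in> space ?P. r * (real n * t) \<le> r * ?S n \<kappa>} :: _ \<Rightarrow> real)"
        using E by (rule integrable_real_indicator) (simp add: emeasure_eq_measure del: One_nat_def)
    qed (use Fle in \<open>auto simp: indicator_def\<close>)
    also have "\<dots> = prob {\<kappa> \<in> space ?P. r * (real n * t) \<le> r * ?S n \<kappa>}"
      using E sets.sets_into_space[OF E] by (simp add: Int_absorb2)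
    also have "\<dots> \<le> exp (real n * (measure \<mu> B * (exp r - 1) - r * t))"
      by (rule chernoff_poisson[OF \<mu> B])
    also have "\<dots> \<le> exp (- d * real n)"
      using mult_left_mono[OF r, of "real n"] by (simp add: algebra_simps)
    finally show ?thesis .
  qed
  show ?thesis
  proof (rule exp_separableI[where K=K and c=d and N=0])
    fix n \<mu> assume "\<mu> \<in> {\<mu> \<in> finite_measures. measure \<mu> B \<le> a}"
    then have \<mu>: "\<mu> \<in> finite_measures" and le: "measure \<mu> B \<le> a" by auto
    have "K n \<kappa> \<le> indicator {\<kappa>. s * (real n * t) \<le> s * ?S n \<kappa>} \<kappa>" for \<kappa>
      using s(1) by (auto simp: K_def)
    moreover have "measure \<mu> B * (exp s - 1) - s * t \<le> - d"
      using s(3)[OF le] d by linarith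
    ultimately show "expectation_under n \<mu> (K n) \<le> exp (- d * real n)"
      by (rule final[OF \<mu> test])
  next
    fix n \<mu> assume "\<mu> \<in> {\<mu> \<in> finite_measures. b \<le> measure \<mu> B}"
    then have \<mu>: "\<mu> \<in> finite_measures" and le: "b \<le> measure \<mu> B" by auto
    have "1 - K n \<kappa> \<le> indicator {\<kappa>. s' * (real n * t) \<le> s' * ?S n \<kappa>} \<kappa>" for \<kappa>
      using s'(1) by (auto simp: K_def)
    moreover have "measure \<mu> B * (exp s' - 1) - s' * t \<le> - d"
      using s'(3)[OF le] d by linarith
    ultimately show "expectation_under n \<mu> (\<lambda>\<kappa>. 1 - K n \<kappa>) \<le> exp (- d * real n)"
      by (rule final[OF \<mu> is_test_compl[OF test]])
  qed (use test d in auto)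
qed

section \<open>Separating a relatively compact hypothesis\<close>
definition tau_nbhd :: "'a::t2_space measure \<Rightarrow> 'a set set \<Rightarrow> real \<Rightarrow> 'a measure set" where
  "tau_nbhd \<mu> F \<epsilon> = {\<nu> \<in> finite_measures. \<forall>B\<in>F. \<bar>measure \<nu> B - measure \<mu> B\<bar> < \<epsilon>}"

lemma openin_tau_nbhd:
  assumes "finite F" "F \<subseteq> sets borel"
  shows "openin tau_topology (tau_nbhd \<mu> F \<epsilon>)"
  using assms
proof (induction F)
  case empty
  show ?case using openin_topspace[of tau_topology] by (simp add: tau_nbhd_def topspace_tau_topology)
next
  case (insert B F)
  have "openin tau_topology {\<nu> \<in> topspace tau_topology. measure \<nu> B \<in> ball (measure \<mu> B) \<epsilon>}"
    using insert by (intro openin_continuous_map_preimage[OF continuous_map_tau_topology]) auto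
  then have "openin tau_topology ({\<nu> \<in> topspace tau_topology. measure \<nu> B \<in> ball (measure \<mu> B) \<epsilon>} \<inter> tau_nbhd \<mu> F \<epsilon>)"
    using insert by (intro openin_Int) auto
  also have "{\<nu> \<in> topspace tau_topology. measure \<nu> B \<in> ball (measure \<mu> B) \<epsilon>} \<inter> tau_nbhd \<mu> F \<epsilon> = tau_nbhd \<mu> (insert B F) \<epsilon>"
    by (auto simp: tau_nbhd_def topspace_tau_topology dist_real_def abs_minus_commute)
  finally show ?case .
qed

lemma tau_nbhd_base:
  assumes "openin tau_topology U" "\<mu> \<in> U"
  shows "\<exists>F \<epsilon>. finite F \<and> F \<subseteq> sets borel \<and> 0 < \<epsilon> \<and> tau_nbhd \<mu> F \<epsilon> \<subseteq> U"
proof -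
  have "generate_topology_on {{\<mu> \<in> finite_measures. measure \<mu> B \<in> V} | B V. B \<in> sets borel \<and> open V} U"
    using assms(1) unfolding tau_topology_def openin_topology_generated_by_iff .
  then show ?thesis using assms(2)
  proof induction
    case Empty then show ?case by simp
  next
    case (Int U V)
    then obtain F \<epsilon> G \<eta> where "finite F" "F \<subseteq> sets borel" "0 < \<epsilon>" "tau_nbhd \<mu> F \<epsilon> \<subseteq> U"
      "finite G" "G \<subseteq> sets borel" "0 < \<eta>" "tau_nbhd \<mu> G \<eta> \<subseteq> V" by blast
    moreover have "tau_nbhd \<mu> (F \<union> G) (min \<epsilon> \<eta>) \<subseteq> tau_nbhd \<mu> F \<epsilon> \<inter> tau_nbhd \<mu> G \<eta>"
      by (auto simp: tau_nbhd_def)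
    ultimately show ?case
      by (intro exI[of _ "F \<union> G"] exI[of _ "min \<epsilon> \<eta>"]) auto
  next
    case (UN \<U>)
    then show ?case by (meson Union_upper UnionE subset_trans)
  next
    case (Basis W)
    then obtain B V where W: "W = {\<mu> \<in> finite_measures. measure \<mu> B \<in> V}" "B \<in> sets borel" "open V" by auto
    then have "measure \<mu> B \<in> V" using Basis(2) by auto
    then obtain \<epsilon> where "0 < \<epsilon>" "ball (measure \<mu> B) \<epsilon> \<subseteq> V" using W(3) openE by blast
    then have "tau_nbhd \<mu> {B} \<epsilon> \<subseteq> W"
      by (auto simp: tau_nbhd_def W dist_real_def abs_minus_commute subset_eq)
    then show ?case using \<open>0 < \<epsilon>\<close> W(2) by (intro exI[of _ "{B}"] exI[of _ \<epsilon>]) auto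
  qed
qed

text \<open>A measure outside the larger neighbourhood violates one of finitely many one-sided inequalities
  by at least \<open>\<epsilon>\<close>, while the smaller neighbourhood satisfies each of them with a margin of
  \<open>\<epsilon> / 2\<close>.\<close>
lemma exp_separable_tau_nbhd:
  assumes F: "finite F" "F \<subseteq> sets borel" and \<epsilon>: "0 < \<epsilon>"
  shows "exp_separable (tau_nbhd \<mu> F (\<epsilon> / 2)) (finite_measures - tau_nbhd \<mu> F \<epsilon>)"
proof -
  let ?W = "tau_nbhd \<mu> F (\<epsilon> / 2)"
  let ?up = "\<lambda>B. {\<nu> \<in> finite_measures. measure \<mu> B + \<epsilon> \<le> measure \<nu> B}"
  let ?lo = "\<lambda>B. {\<nu> \<in> finite_measures. measure \<nu> B \<le> measure \<mu> B - \<epsilon>}"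
  have W: "?W \<subseteq> finite_measures" by (auto simp: tau_nbhd_def)
  have one: "exp_separable (?up B \<union> ?lo B) ?W" if "B \<in> F" for B
  proof (rule exp_separable_Un_left[OF _ _ W])
    have B: "B \<in> sets borel" using that F by auto
    have WB: "measure \<nu> B \<le> measure \<mu> B + \<epsilon> / 2 \<and> measure \<mu> B - \<epsilon> / 2 \<le> measure \<nu> B" if "\<nu> \<in> ?W" for \<nu>
    proof -
      have "\<bar>measure \<nu> B - measure \<mu> B\<bar> < \<epsilon> / 2" using that \<open>B \<in> F\<close> by (simp add: tau_nbhd_def)
      then show ?thesis by arith
    qed
    have "exp_separable {\<nu> \<in> finite_measures. measure \<nu> B \<le> measure \<mu> B + \<epsilon> / 2} (?up B)"
      using \<epsilon> by (intro exp_separable_count[OF B]) auto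
    from exp_separable_sym[OF this] show "exp_separable (?up B) ?W"
      by (rule exp_separable_mono) (use WB W in auto)
    have "exp_separable (?lo B) {\<nu> \<in> finite_measures. measure \<mu> B - \<epsilon> / 2 \<le> measure \<nu> B}"
      using \<epsilon> by (intro exp_separable_count[OF B]) auto
    then show "exp_separable (?lo B) ?W"
      by (rule exp_separable_mono) (use WB W in auto)
  qed auto
  have "exp_separable (\<Union>B\<in>F. ?up B \<union> ?lo B) ?W"
    by (intro exp_separable_UN_left F(1) one W) auto
  then have "exp_separable (finite_measures - tau_nbhd \<mu> F \<epsilon>) ?W"
    by (rule exp_separable_mono) (auto simp: tau_nbhd_def not_less abs_real_def split: if_splits)
  then show ?thesis by (rule exp_separable_sym)
qed

lemma compactin_finite_subcover:
  assumes "compactin X C" "\<And>l. l \<in> C \<Longrightarrow> openin X (U l)" "\<And>l. l \<in> C \<Longrightarrow> l \<in> U l"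
  obtains T where "finite T" "T \<subseteq> C" "C \<subseteq> (\<Union>l\<in>T. U l)"
proof -
  have "\<forall>V\<in>U ` C. openin X V" "C \<subseteq> \<Union>(U ` C)" using assms by auto
  then obtain \<F> where F: "finite \<F>" "\<F> \<subseteq> U ` C" "C \<subseteq> \<Union>\<F>"
    using assms(1) unfolding compactin_def by meson
  obtain T where "T \<subseteq> C" "finite T" "\<F> = U ` T"
    using finite_subset_image[OF F(1,2)] by blast
  with F(3) show ?thesis by (intro that[of T]) auto
qed

text \<open>Each point of the compact closure of \<open>A\<close> has a basic neighbourhood disjoint from the closed set
  \<open>closure_of B\<close>. The neighbourhoods of half the radius already cover, so finitely many suffice, and
  each of them is separable from \<open>B\<close>.\<close>
lemma exp_separable_of_compact:
  assumes fin: "A \<subseteq> finite_measures" "B \<subseteq> finite_measures"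
    and comp: "tau_relatively_compact A"
    and disj: "(tau_topology closure_of A) \<inter> (tau_topology closure_of B) = {}"
  shows "exp_separable A B"
proof -
  let ?C = "tau_topology closure_of A" and ?D = "tau_topology closure_of B"
  have AC: "A \<subseteq> ?C" and BD: "B \<subseteq> ?D"
    using fin by (auto intro!: closure_of_subset simp: topspace_tau_topology)
  have "\<exists>F \<epsilon>. finite F \<and> F \<subseteq> sets borel \<and> 0 < \<epsilon> \<and> tau_nbhd \<mu> F \<epsilon> \<subseteq> topspace tau_topology - ?D"
    if "\<mu> \<in> ?C" for \<mu>
  proof (rule tau_nbhd_base)
    show "openin tau_topology (topspace tau_topology - ?D)" by (intro openin_diff) auto
    show "\<mu> \<in> topspace tau_topology - ?D"
      using that disj closure_of_subset_topspace[of tau_topology A] by blast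
  qed
  then obtain F \<epsilon> where F: "\<And>\<mu>. \<mu> \<in> ?C \<Longrightarrow> finite (F \<mu>) \<and> F \<mu> \<subseteq> sets borel \<and> 0 < \<epsilon> \<mu> \<and> tau_nbhd \<mu> (F \<mu>) (\<epsilon> \<mu>) \<subseteq> topspace tau_topology - ?D"
    by metis
  let ?W = "\<lambda>\<mu>. tau_nbhd \<mu> (F \<mu>) (\<epsilon> \<mu> / 2)"
  have W: "\<mu> \<in> ?W \<mu>" if "\<mu> \<in> ?C" for \<mu>
  proof -
    have "\<mu> \<in> finite_measures" using that closure_of_subset_topspace[of tau_topology A] by (auto simp: topspace_tau_topology)
    then show ?thesis using F[OF that] by (auto simp: tau_nbhd_def)
  qed
  obtain T where T: "finite T" "T \<subseteq> ?C" "?C \<subseteq> (\<Union>\<mu>\<in>T. ?W \<mu>)"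
  proof (rule compactin_finite_subcover[of tau_topology ?C ?W])
    show "compactin tau_topology ?C" using comp by (simp add: tau_relatively_compact_def)
    show "openin tau_topology (?W \<mu>)" if "\<mu> \<in> ?C" for \<mu>
      using F[OF that] by (intro openin_tau_nbhd) auto
  qed (rule W)
  have "exp_separable (?W \<mu>) B" if "\<mu> \<in> T" for \<mu>
  proof (rule exp_separable_mono[OF exp_separable_tau_nbhd])
    have \<mu>: "\<mu> \<in> ?C" using that T by auto
    show "finite (F \<mu>)" "F \<mu> \<subseteq> sets borel" "0 < \<epsilon> \<mu>" using F[OF \<mu>] by auto
    show "B \<subseteq> finite_measures - tau_nbhd \<mu> (F \<mu>) (\<epsilon> \<mu>)" using F[OF \<mu>] BD fin by blast
  qed simp
  then have "exp_separable (\<Union>\<mu>\<in>T. ?W \<mu>) B"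
    using T(1) fin(2) by (intro exp_separable_UN_left) (auto simp: tau_nbhd_def)
  then show ?thesis
    by (rule exp_separable_mono) (use AC T in auto)
qed

text \<open>Once \<open>exp (- c * n)\<close> is below the level, the separating tests have the required first error; for
  the finitely many smaller \<open>n\<close>, never rejecting has first error 0.\<close>
lemma exp_separable_imp_distinguishable:
  fixes A B :: "'a::t2_space measure set"
  assumes "exp_separable A B"
  shows "distinguishable A B"
proof -
  obtain K c n0 where K: "\<And>n. n \<ge> 1 \<Longrightarrow> is_test n (K n)" "c > 0"
    "\<And>n. n > n0 \<Longrightarrow> alpha_error A n (K n) \<le> ennreal (exp (- c * real n))"
    "\<And>n. n > n0 \<Longrightarrow> beta_error B n (K n) \<le> ennreal (exp (- c * real n))"
    using assms unfolding exp_separable_def by blast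
  have lim: "(\<lambda>n. exp (- c * real n)) \<longlonglongrightarrow> 0"
    using K(2) by real_asymp
  show ?thesis
    unfolding distinguishable_def
  proof (intro allI impI)
    fix a :: real assume a: "0 < a" "a < 1"
    obtain n1 where n1: "\<And>n. n \<ge> n1 \<Longrightarrow> exp (- c * real n) < a"
      using order_tendstoD(2)[OF lim a(1)] by (auto simp: eventually_sequentially)
    define N where "N = max (Suc n0) n1"
    let ?K = "\<lambda>n \<kappa>. if n \<ge> N then K n \<kappa> else 0"
    show "\<exists>K. (\<forall>n\<ge>1. is_test n (K n) \<and> alpha_error A n (K n) < ennreal a) \<and> (\<lambda>n. beta_error B n (K n)) \<longlonglongrightarrow> 0"
    proof (intro exI[of _ ?K] conjI allI impI)
      fix n :: nat assume n: "n \<ge> 1"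
      show "is_test n (?K n)" using K(1)[OF n] by (cases "n \<ge> N") (auto simp: is_test_def)
      show "alpha_error A n (?K n) < ennreal a"
      proof (cases "n \<ge> N")
        case True
        then have "alpha_error A n (K n) \<le> ennreal (exp (- c * real n))"
          by (intro K(3)) (auto simp: N_def)
        also have "\<dots> < ennreal a" using n1[of n] True by (intro ennreal_lessI) (auto simp: N_def a)
        finally show ?thesis using True by simp
      next
        case False
        have "alpha_error A n (\<lambda>_. 0) \<le> ennreal 0" 
          by (subst alpha_error_le_iff) (auto simp: expectation_under_def)
        then show ?thesis using False a by (simp add: le_zero_eq)
      qed
    next
      show "(\<lambda>n. beta_error B n (?K n)) \<longlonglongrightarrow> 0"
      proof (rule tendsto_sandwich[OF _ _ tendsto_const])
        show "(\<lambda>n. ennreal (exp (- c * real n))) \<longlonglongrightarrow> 0"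
          using tendsto_ennrealI[OF lim] by simp
        show "\<forall>\<^sub>F n in sequentially. beta_error B n (?K n) \<le> ennreal (exp (- c * real n))"
          using K(4) by (intro eventually_sequentiallyI[of N]) (auto simp: N_def)
      qed auto
    qed
  qed
qed

section \<open>Restricting measures to sub-sigma-algebras\<close>
lemma emeasure_distr_subalgebra:
  assumes "sets N \<subseteq> sets P" "space N = space P" "A \<in> sets N"
  shows "emeasure (distr P N (\<lambda>x. x)) A = emeasure P A"
proof -
  have "(\<lambda>x. x) \<in> measurable P N" using assms by (auto simp: measurable_def)
  moreover have "A \<subseteq> space P" using sets.sets_into_space[OF assms(3)] assms(2) by simp
  ultimately show ?thesis using assms(3) by (simp add: emeasure_distr Int_absorb2)
qed

lemma measurable_PiM_subalgebra:
  assumes "sets N \<subseteq> sets P" "space N = space P"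
  shows "(\<lambda>x. x) \<in> measurable (PiM I (\<lambda>_. P)) (PiM I (\<lambda>_. N))"
proof (rule measurable_PiM_single)
  show "(\<lambda>x. x) \<in> space (PiM I (\<lambda>_. P)) \<rightarrow> (\<Pi>\<^sub>E i\<in>I. space N)"
    using assms by (auto simp: space_PiM)
  fix A i assume "i \<in> I" "A \<in> sets N"
  then have "A \<in> sets P" using assms by auto
  then show "{\<omega> \<in> space (PiM I (\<lambda>_. P)). \<omega> i \<in> A} \<in> sets (PiM I (\<lambda>_. P))"
    using \<open>i \<in> I\<close> by measurable
qed

text \<open>Mean measures will converge only on a sub-sigma-algebra \<open>N\<close>, whereas laws of the process are
  built from powers of the full measures. On the power of \<open>N\<close> it makes no difference whether one
  restricts before or after forming the power.\<close>
lemma PiM_distr_subalgebra: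
  assumes "finite I" "finite_measure P" "sets N \<subseteq> sets P" "space N = space P"
  shows "distr (PiM I (\<lambda>_. P)) (PiM I (\<lambda>_. N)) (\<lambda>x. x) = PiM I (\<lambda>_. distr P N (\<lambda>x. x))"
proof -
  have id: "(\<lambda>x. x) \<in> measurable P N" using assms by (auto simp: measurable_def)
  have fin: "finite_measure (distr P N (\<lambda>x. x))"
    by (rule finite_measure.finite_measure_distr[OF assms(2) id])
  interpret P: product_sigma_finite "\<lambda>_. P"
    using assms(2) by (auto simp: product_sigma_finite_def finite_measure_def)
  interpret N: product_sigma_finite "\<lambda>_. distr P N (\<lambda>x. x)"
    using fin by (auto simp: product_sigma_finite_def finite_measure_def)
  show ?thesis
  proof (rule N.PiM_eqI[OF assms(1)])
    show "sets (distr (PiM I (\<lambda>_. P)) (PiM I (\<lambda>_. N)) (\<lambda>x. x)) = sets (PiM I (\<lambda>_. distr P N (\<lambda>x. x)))"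
      by (simp cong: sets_PiM_cong)
  next
    fix A assume "\<And>i. i \<in> I \<Longrightarrow> A i \<in> sets (distr P N (\<lambda>x. x))"
    then have A: "A i \<in> sets N" if "i \<in> I" for i using that by simp
    then have AP: "A i \<in> sets P" if "i \<in> I" for i using that assms(3) by auto
    have "PiE I A \<in> sets (PiM I (\<lambda>_. N))" using A assms(1) by (intro sets_PiM_I_finite) auto
    moreover have "PiE I A \<subseteq> space (PiM I (\<lambda>_. P))"
      using AP sets.sets_into_space by (force simp: space_PiM PiE_iff)
    ultimately have "emeasure (distr (PiM I (\<lambda>_. P)) (PiM I (\<lambda>_. N)) (\<lambda>x. x)) (PiE I A) = emeasure (PiM I (\<lambda>_. P)) (PiE I A)"
      using measurable_PiM_subalgebra[OF assms(3,4), of I] by (simp add: emeasure_distr Int_absorb2)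
    also have "\<dots> = (\<Prod>i\<in>I. emeasure P (A i))" by (rule P.emeasure_PiM[OF assms(1) AP])
    also have "\<dots> = (\<Prod>i\<in>I. emeasure (distr P N (\<lambda>x. x)) (A i))"
      using emeasure_distr_subalgebra[OF assms(3,4) A] by simp
    finally show "emeasure (distr (PiM I (\<lambda>_. P)) (PiM I (\<lambda>_. N)) (\<lambda>x. x)) (PiE I A) = (\<Prod>i\<in>I. emeasure (distr P N (\<lambda>x. x)) (A i))" .
  qed
qed

section \<open>Convergence of the laws of the process\<close>
lemma sets_config_space_on_mono:
  "sets N \<subseteq> sets N' \<Longrightarrow> sets (config_space_on N) \<subseteq> sets (config_space_on N')"
  unfolding sets_config_space_on by (intro sigma_sets_mono') blast

lemma sets_config_space_on_subset:
  "sets N \<subseteq> sets borel \<Longrightarrow> sets (config_space_on N) \<subseteq> sets configuration_space"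
  unfolding configuration_space_eq by (rule sets_config_space_on_mono)

text \<open>Each term of the series converges because powers preserve setwise convergence. Since the total
  masses are bounded by some \<open>L\<close>, the terms are dominated by \<open>L\<^sup>m / m!\<close>, and Tannery's theorem
  exchanges the limit with the sum.\<close>
lemma poisson_mixture_tendsto:
  fixes N :: "'a::t2_space measure"
  assumes N: "sets N \<subseteq> sets borel" "space N = UNIV"
    and \<mu>: "\<And>k. \<mu> k \<in> finite_measures" and \<nu>: "\<nu> \<in> finite_measures"
    and lim: "\<And>B. B \<in> sets N \<Longrightarrow> (\<lambda>k. measure (\<mu> k) B) \<longlonglongrightarrow> measure \<nu> B"
    and A: "A \<in> sets (config_space_on N)"
  shows "(\<lambda>k. measure (poisson_mixture (\<mu> k)) A) \<longlonglongrightarrow> measure (poisson_mixture \<nu>) A"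
proof -
  define r where "r \<mu> = distr \<mu> N (\<lambda>x. x)" for \<mu> :: "'a measure"
  let ?Z = "\<lambda>m. point_config m -` A \<inter> space (PiM {..<m} (\<lambda>_. N))"
  have Z: "?Z m \<in> sets (PiM {..<m} (\<lambda>_. N))" for m
    using measurable_sets[OF measurable_point_config[OF N(1)] A] .
  have A': "A \<in> sets configuration_space" using A sets_config_space_on_subset[OF N(1)] by auto
  have fm: "finite_measure \<mu>" "sets \<mu> = sets borel" "space \<mu> = UNIV" if "\<mu> \<in> finite_measures" for \<mu> :: "'a measure"
    using that sets_eq_imp_space_eq[of \<mu> borel] by (auto simp: finite_measures_def)
  have id: "(\<lambda>x. x) \<in> measurable \<mu> N" if "\<mu> \<in> finite_measures" for \<mu> 
    using N fm[OF that] by (auto simp: measurable_def)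
  have fr: "finite_measure (r \<mu>)" if "\<mu> \<in> finite_measures" for \<mu> 
    unfolding r_def by (rule finite_measure.finite_measure_distr[OF fm(1)[OF that] id[OF that]])
  have mr: "measure (r \<mu>) B = measure \<mu> B" if "\<mu> \<in> finite_measures" "B \<in> sets N" for \<mu> B
    unfolding r_def measure_def using fm[OF that(1)] N that(2) by (subst emeasure_distr_subalgebra) auto
  have UN: "UNIV \<in> sets N" using N(2) sets.top[of N] by simp
  have em: "emeasure (PiM {..<m} (\<lambda>_. \<mu>)) (point_config m -` A \<inter> space (PiM {..<m} (\<lambda>_. \<mu>))) = ennreal (measure (PiM {..<m} (\<lambda>_. r \<mu>)) (?Z m))"
    if "\<mu> \<in> finite_measures" for \<mu> m
  proof -
    have "emeasure (PiM {..<m} (\<lambda>_. r \<mu>)) (?Z m) = emeasure (distr (PiM {..<m} (\<lambda>_. \<mu>)) (PiM {..<m} (\<lambda>_. N)) (\<lambda>x. x)) (?Z m)"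
      unfolding r_def using PiM_distr_subalgebra[of "{..<m}" \<mu> N] fm[OF that] N by simp
    also have "\<dots> = emeasure (PiM {..<m} (\<lambda>_. \<mu>)) ((\<lambda>x. x) -` ?Z m \<inter> space (PiM {..<m} (\<lambda>_. \<mu>)))"
      using fm[OF that] N by (intro emeasure_distr measurable_PiM_subalgebra Z) auto
    also have "(\<lambda>x. x) -` ?Z m \<inter> space (PiM {..<m} (\<lambda>_. \<mu>)) = point_config m -` A \<inter> space (PiM {..<m} (\<lambda>_. \<mu>))"
      using fm[OF that] N(2) by (simp add: space_PiM)
    finally show ?thesis
      using finite_measure.emeasure_eq_measure[OF finite_measure_PiM[OF fr[OF that], of "{..<m}"]] by simp
  qed
  define T where "T \<mu> m = exp (- measure \<mu> UNIV) / fact m * measure (PiM {..<m} (\<lambda>_. r \<mu>)) (?Z m)" for \<mu> m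
  have T0: "0 \<le> T \<mu> m" for \<mu> m by (simp add: T_def)
  have Tb: "T \<mu> m \<le> measure \<mu> UNIV ^ m / fact m" if "\<mu> \<in> finite_measures" for \<mu> m
  proof -
    interpret PM: finite_measure "PiM {..<m} (\<lambda>_. r \<mu>)" by (rule finite_measure_PiM[OF fr[OF that]]) simp
    interpret P: product_sigma_finite "\<lambda>_::nat. r \<mu>"
      using fr[OF that] by (auto simp: product_sigma_finite_def finite_measure_def)
    have "emeasure (PiM {..<m} (\<lambda>_. r \<mu>)) (space (PiM {..<m} (\<lambda>_. r \<mu>))) = ennreal (measure \<mu> UNIV ^ m)"
      using P.emeasure_PiM[of "{..<m}" "\<lambda>_. space (r \<mu>)"] mr[OF that UN] N(2)
      by (simp add: space_PiM finite_measure.emeasure_eq_measure[OF fr[OF that]] ennreal_power) (simp add: r_def)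
    then have "measure (PiM {..<m} (\<lambda>_. r \<mu>)) (space (PiM {..<m} (\<lambda>_. r \<mu>))) = measure \<mu> UNIV ^ m"
      by (simp add: measure_def)
    then have "measure (PiM {..<m} (\<lambda>_. r \<mu>)) (?Z m) \<le> measure \<mu> UNIV ^ m"
      using PM.bounded_measure[of "?Z m"] by simp
    then have "exp (- measure \<mu> UNIV) * measure (PiM {..<m} (\<lambda>_. r \<mu>)) (?Z m) \<le> 1 * measure \<mu> UNIV ^ m"
      by (intro mult_mono) auto
    then show ?thesis by (simp add: T_def divide_right_mono)
  qed
  have sum_exp: "summable (\<lambda>m. (x::real) ^ m / fact m)" for x
    using summable_exp[of x] by (simp add: field_simps)
  have sumT: "summable (T \<mu>)" if "\<mu> \<in> finite_measures" for \<mu>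
    by (rule summable_comparison_test'[OF sum_exp[of "measure \<mu> UNIV"]]) (use T0 Tb[OF that] in auto)
  have mix: "measure (poisson_mixture \<mu>) A = suminf (T \<mu>)" if "\<mu> \<in> finite_measures" for \<mu>
  proof -
    have "emeasure (poisson_mixture \<mu>) A = (\<Sum>m. ennreal (T \<mu> m))"
      unfolding emeasure_poisson_mixture[OF that A'] em[OF that] T_def
      by (intro suminf_cong ennreal_mult'[symmetric]) auto
    also have "\<dots> = ennreal (suminf (T \<mu>))"
      using T0 by (intro suminf_ennreal_eq summable_sums sumT that) auto
    finally show ?thesis using suminf_nonneg[OF sumT[OF that] T0] by (simp add: measure_def)
  qed
  have setw: "setwise_tendsto (\<lambda>k. r (\<mu> k)) (r \<nu>)"
    unfolding setwise_tendsto_def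
  proof (intro conjI allI ballI)
    show "sets (r (\<mu> k)) = sets (r \<nu>)" for k by (simp add: r_def)
    fix B assume "B \<in> sets (r \<nu>)"
    then have B: "B \<in> sets N" by (simp add: r_def)
    show "(\<lambda>k. measure (r (\<mu> k)) B) \<longlonglongrightarrow> measure (r \<nu>) B"
      using lim[OF B] by (simp add: mr[OF \<mu> B] mr[OF \<nu> B])
  qed (use fr \<mu> \<nu> in auto)
  have PZ: "(\<lambda>k. measure (PiM {..<m} (\<lambda>_. r (\<mu> k))) (?Z m)) \<longlonglongrightarrow> measure (PiM {..<m} (\<lambda>_. r \<nu>)) (?Z m)" for m
  proof -
    have s: "sets (PiM {..<m} (\<lambda>_. r \<mu>)) = sets (PiM {..<m} (\<lambda>_. N))" for \<mu> :: "'a measure"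
      by (intro sets_PiM_cong) (auto simp: r_def)
    have sp: "?Z m \<inter> space (PiM {..<m} (\<lambda>_. r \<mu>)) = ?Z m" for \<mu> :: "'a measure"
      by (auto simp: space_PiM r_def)
    have "(\<lambda>k. \<integral>x. indicator (?Z m) x \<partial>PiM {..<m} (\<lambda>_. r (\<mu> k))) \<longlonglongrightarrow> (\<integral>x. (indicator (?Z m) x::real) \<partial>PiM {..<m} (\<lambda>_. r \<nu>))"
    proof (rule PiM_integral_tendsto_setwise[OF _ setw])
      show "(indicator (?Z m) :: _ \<Rightarrow> real) \<in> borel_measurable (PiM {..<m} (\<lambda>_. r \<nu>))"
        using Z[of m] unfolding measurable_cong_sets[OF s refl] by (rule borel_measurable_indicator)
    qed (auto split: split_indicator)
    then show ?thesis by (simp only: Bochner_Integration.integral_indicator sp) 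
  qed
  have limU: "(\<lambda>k. measure (\<mu> k) UNIV) \<longlonglongrightarrow> measure \<nu> UNIV" by (rule lim[OF UN])
  then obtain L where L: "\<And>k. measure (\<mu> k) UNIV \<le> L"
    using convergent_imp_Bseq[of "\<lambda>k. measure (\<mu> k) UNIV"] by (auto simp: Bseq_def convergent_def)
  have "(\<lambda>k. suminf (T (\<mu> k))) \<longlonglongrightarrow> suminf (T \<nu>)"
  proof (rule tannerys_theorem[THEN conjunct2, THEN conjunct2])
    show "(\<lambda>k. T (\<mu> k) m) \<longlonglongrightarrow> T \<nu> m" for m
      unfolding T_def by (intro tendsto_intros limU PZ) auto
    have "norm (T (\<mu> k) m) \<le> L ^ m / fact m" for k m
    proof -
      have "T (\<mu> k) m \<le> L ^ m / fact m"
        by (rule order_trans[OF Tb[OF \<mu>]]) (auto intro!: divide_right_mono power_mono L)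
      then show ?thesis using T0 by simp
    qed
    then show "\<forall>\<^sub>F (m, k) in at_top \<times>\<^sub>F sequentially. norm (T (\<mu> k) m) \<le> L ^ m / fact m"
      by (intro always_eventually) auto
  qed (use sum_exp in auto)
  then show ?thesis by (simp add: mix \<mu> \<nu>)
qed

text \<open>The laws of one realisation converge setwise on the configuration space over \<open>N\<close>; the sample of
  size \<open>n\<close> is a second finite power, to which the same convergence of powers applies.\<close>
lemma expectation_under_tendsto:
  fixes N :: "'a::t2_space measure"
  assumes N: "sets N \<subseteq> sets borel" "space N = UNIV"
    and \<mu>: "\<And>k. \<mu> k \<in> finite_measures" and \<nu>: "\<nu> \<in> finite_measures"
    and lim: "\<And>B. B \<in> sets N \<Longrightarrow> (\<lambda>k. measure (\<mu> k) B) \<longlonglongrightarrow> measure \<nu> B"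
    and K: "is_test n K" "K \<in> borel_measurable (PiM {1..n} (\<lambda>_. config_space_on N))"
  shows "(\<lambda>k. expectation_under n (\<mu> k) K) \<longlonglongrightarrow> expectation_under n \<nu> K"
proof -
  let ?C = "config_space_on N"
  define r where "r \<mu> = distr (poisson_mixture \<mu>) ?C (\<lambda>x. x)" for \<mu> :: "'a measure"
  have sub: "sets ?C \<subseteq> sets (poisson_mixture \<mu>)" "space ?C = space (poisson_mixture \<mu>)" for \<mu>
    using sets_config_space_on_subset[OF N(1)] by auto
  have id: "(\<lambda>x. x) \<in> measurable (poisson_mixture \<mu>) ?C" for \<mu>
    using sub[of \<mu>] by (auto simp: measurable_def)
  have fin: "finite_measure (poisson_mixture \<mu>)" if "\<mu> \<in> finite_measures" for \<mu> :: "'a measure"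
    using prob_space_poisson_mixture[OF that] by (simp add: prob_space_def)
  have fr: "finite_measure (r \<mu>)" if "\<mu> \<in> finite_measures" for \<mu>
    unfolding r_def by (rule finite_measure.finite_measure_distr[OF fin[OF that] id])
  have mr: "measure (r \<mu>) A = measure (poisson_mixture \<mu>) A" if "A \<in> sets ?C" for \<mu> A
    unfolding r_def measure_def using sub[of \<mu>] that by (subst emeasure_distr_subalgebra) auto
  have setw: "setwise_tendsto (\<lambda>k. r (\<mu> k)) (r \<nu>)"
    unfolding setwise_tendsto_def
  proof (intro conjI allI ballI)
    show "sets (r (\<mu> k)) = sets (r \<nu>)" for k by (simp add: r_def)
    fix A assume "A \<in> sets (r \<nu>)"
    then have A: "A \<in> sets ?C" by (simp add: r_def)
    show "(\<lambda>k. measure (r (\<mu> k)) A) \<longlonglongrightarrow> measure (r \<nu>) A"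
      unfolding mr[OF A] by (rule poisson_mixture_tendsto[OF N \<mu> \<nu> lim A])
  qed (use fr \<mu> \<nu> in auto)
  have E: "expectation_under n \<mu> K = (\<integral>\<kappa>. K \<kappa> \<partial>PiM {1..n} (\<lambda>_. r \<mu>))" if "\<mu> \<in> finite_measures" for \<mu>
  proof -
    have "(\<integral>\<kappa>. K \<kappa> \<partial>PiM {1..n} (\<lambda>_. r \<mu>)) = (\<integral>\<kappa>. K \<kappa> \<partial>distr (PiM {1..n} (\<lambda>_. poisson_mixture \<mu>)) (PiM {1..n} (\<lambda>_. ?C)) (\<lambda>x. x))"
      unfolding r_def using PiM_distr_subalgebra[OF _ fin[OF that] sub, of "{1..n}"] by simp
    also have "\<dots> = (\<integral>\<kappa>. K \<kappa> \<partial>PiM {1..n} (\<lambda>_. poisson_mixture \<mu>))"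
      by (intro integral_distr measurable_PiM_subalgebra sub K(2))
    finally show ?thesis by (simp add: expectation_under_def poisson_law_eq[OF that])
  qed
  have s: "sets (PiM {1..n} (\<lambda>_. r \<nu>)) = sets (PiM {1..n} (\<lambda>_. ?C))"
    by (intro sets_PiM_cong) (auto simp: r_def)
  have "(\<lambda>k. \<integral>\<kappa>. K \<kappa> \<partial>PiM {1..n} (\<lambda>_. r (\<mu> k))) \<longlonglongrightarrow> (\<integral>\<kappa>. K \<kappa> \<partial>PiM {1..n} (\<lambda>_. r \<nu>))"
  proof (rule PiM_integral_tendsto_setwise[OF _ setw])
    show "K \<in> borel_measurable (PiM {1..n} (\<lambda>_. r \<nu>))"
      using K(2) unfolding measurable_cong_sets[OF s refl] .
    fix \<kappa> assume "\<kappa> \<in> space (PiM {1..n} (\<lambda>_. r \<nu>))"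
    then have "\<kappa> \<in> space (PiM {1..n} (\<lambda>_. configuration_space))" by (simp add: space_PiM r_def)
    then show "K \<kappa> \<in> {0..1}" using K(1) by (auto simp: is_test_def)
  qed simp
  then show ?thesis by (simp add: E \<mu> \<nu>)
qed

section \<open>Tests depend on countably many counts\<close>
lemma configuration_event_countably_determined:
  assumes "A \<in> sets (configuration_space :: 'a::t2_space measure measure)"
  shows "\<exists>\<C>. countable \<C> \<and> \<C> \<subseteq> sets borel \<and> A \<in> sets (config_space_on (sigma UNIV \<C>))"
  using assms unfolding configuration_space_eq sets_config_space_on[of borel]
proof (induction A rule: sigma_sets.induct)
  case (Basic Z)
  then obtain A B where Z: "Z = {\<kappa> \<in> configurations. measure \<kappa> B \<in> A}" "A \<in> sets borel" "B \<in> sets borel" by auto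
  have "B \<in> sets (sigma UNIV {B})" by auto
  then have "Z \<in> sets (config_space_on (sigma UNIV {B}))"
    unfolding sets_config_space_on using Z by (intro sigma_sets.Basic) blast
  then show ?case using Z(3) by (intro exI[of _ "{B}"]) auto
next
  case Empty
  show ?case by (intro exI[of _ "{}"]) auto
next
  case (Compl Z)
  then obtain \<C> where \<C>: "countable \<C>" "\<C> \<subseteq> sets borel" "Z \<in> sets (config_space_on (sigma UNIV \<C>))" by blast
  then have "configurations - Z \<in> sets (config_space_on (sigma UNIV \<C>))"
    using sets.compl_sets[OF \<C>(3)] by simp
  then show ?case using \<C> by blast
next
  case (Union Z)
  then obtain \<C> where \<C>: "\<And>i. countable (\<C> i)" "\<And>i. \<C> i \<subseteq> sets borel" "\<And>i. Z i \<in> sets (config_space_on (sigma UNIV (\<C> i)))"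
    by metis
  have "sets (config_space_on (sigma UNIV (\<C> i))) \<subseteq> sets (config_space_on (sigma UNIV (\<Union>i. \<C> i)))" for i
    by (intro sets_config_space_on_mono) (auto intro!: sigma_sets_mono')
  then have "Z i \<in> sets (config_space_on (sigma UNIV (\<Union>i. \<C> i)))" for i using \<C>(3) by blast
  then have "(\<Union>i. Z i) \<in> sets (config_space_on (sigma UNIV (\<Union>i. \<C> i)))" by blast
  then show ?case using \<C> by (intro exI[of _ "\<Union>i. \<C> i"]) auto
qed

lemma sets_PiM_config_mono:
  fixes \<C> \<C>' :: "'a::t2_space set set"
  assumes "\<C> \<subseteq> \<C>'"
  shows "sets (PiM I (\<lambda>_. config_space_on (sigma UNIV \<C>))) \<subseteq> sets (PiM I (\<lambda>_. config_space_on (sigma UNIV \<C>')))"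
proof
  fix Z assume Z: "Z \<in> sets (PiM I (\<lambda>_. config_space_on (sigma UNIV \<C>)))"
  have "sets (config_space_on (sigma UNIV \<C>)) \<subseteq> sets (config_space_on (sigma UNIV \<C>'))"
    using assms by (intro sets_config_space_on_mono) (auto intro!: sigma_sets_mono')
  then have "(\<lambda>x. x) \<in> measurable (PiM I (\<lambda>_. config_space_on (sigma UNIV \<C>'))) (PiM I (\<lambda>_. config_space_on (sigma UNIV \<C>)))"
    by (intro measurable_PiM_subalgebra) auto
  from measurable_sets[OF this Z] show "Z \<in> sets (PiM I (\<lambda>_. config_space_on (sigma UNIV \<C>')))"
    using sets.sets_into_space[OF Z] by (simp add: space_PiM Int_absorb2)
qed

lemma sample_event_countably_determined:
  assumes "A \<in> sets (PiM I (\<lambda>_. configuration_space :: 'a::t2_space measure measure))"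
  shows "\<exists>\<C>. countable \<C> \<and> \<C> \<subseteq> sets borel \<and> A \<in> sets (PiM I (\<lambda>_. config_space_on (sigma UNIV \<C>)))"
  using assms unfolding sets_PiM_single[of I "\<lambda>_. configuration_space"]
proof (induction A rule: sigma_sets.induct)
  case (Basic Z)
  then obtain i A where Z: "Z = {f \<in> \<Pi>\<^sub>E i\<in>I. configurations. f i \<in> A}" "i \<in> I" "A \<in> sets configuration_space" by auto
  obtain \<C> where \<C>: "countable \<C>" "\<C> \<subseteq> sets borel" "A \<in> sets (config_space_on (sigma UNIV \<C>))"
    using configuration_event_countably_determined[OF Z(3)] by blast
  have "{f \<in> space (PiM I (\<lambda>_. config_space_on (sigma UNIV \<C>))). f i \<in> A} \<in> sets (PiM I (\<lambda>_. config_space_on (sigma UNIV \<C>)))"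
    using Z(2) \<C>(3) by measurable
  then show ?case using \<C> by (intro exI[of _ \<C>]) (simp add: Z(1) space_PiM)
next
  case Empty
  show ?case by (intro exI[of _ "{}"]) auto
next
  case (Compl Z)
  then obtain \<C> where \<C>: "countable \<C>" "\<C> \<subseteq> sets borel" "Z \<in> sets (PiM I (\<lambda>_. config_space_on (sigma UNIV \<C>)))" by blast
  then have "(\<Pi>\<^sub>E i\<in>I. configurations) - Z \<in> sets (PiM I (\<lambda>_. config_space_on (sigma UNIV \<C>)))"
    using sets.compl_sets[OF \<C>(3)] by (simp add: space_PiM)
  then show ?case using \<C> by (intro exI[of _ \<C>]) simp
next
  case (Union Z)
  then obtain \<C> where \<C>: "\<And>i. countable (\<C> i)" "\<And>i. \<C> i \<subseteq> sets borel" "\<And>i. Z i \<in> sets (PiM I (\<lambda>_. config_space_on (sigma UNIV (\<C> i))))"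
    by metis
  have "Z i \<in> sets (PiM I (\<lambda>_. config_space_on (sigma UNIV (\<Union>i. \<C> i))))" for i
    using \<C>(3)[of i] sets_PiM_config_mono[of "\<C> i" "\<Union>i. \<C> i" I] by blast
  then have "(\<Union>i. Z i) \<in> sets (PiM I (\<lambda>_. config_space_on (sigma UNIV (\<Union>i. \<C> i))))" by blast
  then show ?case using \<C> by (intro exI[of _ "\<Union>i. \<C> i"]) auto
qed

text \<open>A real function is determined by its sublevel sets at rational levels, and each of them involves
  countably many counts.\<close>
lemma statistic_countably_determined:
  fixes K :: "(nat \<Rightarrow> 'a::t2_space measure) \<Rightarrow> real"
  assumes "K \<in> borel_measurable (PiM I (\<lambda>_. configuration_space))"
  obtains \<C> where "countable \<C>" "\<C> \<subseteq> sets borel"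
    "K \<in> borel_measurable (PiM I (\<lambda>_. config_space_on (sigma UNIV \<C>)))"
proof -
  let ?P = "PiM I (\<lambda>_. configuration_space :: 'a measure measure)"
  have "\<exists>\<C>. countable \<C> \<and> \<C> \<subseteq> sets borel \<and> {\<kappa> \<in> space ?P. K \<kappa> \<le> real_of_rat q} \<in> sets (PiM I (\<lambda>_. config_space_on (sigma UNIV \<C>)))" for q
    using assms by (intro sample_event_countably_determined) measurable
  then have "\<exists>\<C>. \<forall>q. countable (\<C> q) \<and> \<C> q \<subseteq> sets borel \<and>
      {\<kappa> \<in> space ?P. K \<kappa> \<le> real_of_rat q} \<in> sets (PiM I (\<lambda>_. config_space_on (sigma UNIV (\<C> q))))"
    by (intro choice allI)
  then obtain \<C> where "\<forall>q. countable (\<C> q) \<and> \<C> q \<subseteq> sets borel \<and>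
      {\<kappa> \<in> space ?P. K \<kappa> \<le> real_of_rat q} \<in> sets (PiM I (\<lambda>_. config_space_on (sigma UNIV (\<C> q))))" ..
  then have \<C>: "countable (\<C> q)" "\<C> q \<subseteq> sets borel"
    "{\<kappa> \<in> space ?P. K \<kappa> \<le> real_of_rat q} \<in> sets (PiM I (\<lambda>_. config_space_on (sigma UNIV (\<C> q))))" for q
    by (simp_all only: HOL.simp_thms)
  let ?D = "\<Union>q. \<C> q"
  let ?Q = "PiM I (\<lambda>_. config_space_on (sigma UNIV ?D))"
  have sp: "space ?Q = space ?P" by (simp add: space_PiM)
  have q: "{\<kappa> \<in> space ?Q. K \<kappa> \<le> real_of_rat q} \<in> sets ?Q" for q
    unfolding sp using \<C>(3)[of q] sets_PiM_config_mono[of "\<C> q" ?D I] by blast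
  have "K \<in> borel_measurable ?Q"
  proof (rule borel_measurableI_le)
    fix y
    have "{\<kappa> \<in> space ?Q. K \<kappa> \<le> y} = {\<kappa> \<in> space ?Q. \<forall>q. y < real_of_rat q \<longrightarrow> K \<kappa> \<le> real_of_rat q}"
    proof (intro Collect_cong conj_cong refl iffI allI impI)
      fix \<kappa> assume *: "\<forall>q. y < real_of_rat q \<longrightarrow> K \<kappa> \<le> real_of_rat q"
      show "K \<kappa> \<le> y"
      proof (rule ccontr)
        assume "\<not> K \<kappa> \<le> y"
        then obtain q where "y < real_of_rat q" "real_of_rat q < K \<kappa>" using of_rat_dense[of y "K \<kappa>"] by auto
        then show False using * by fastforce
      qed
    qed auto
    also have "\<dots> \<in> sets ?Q"
      by (intro sets.sets_Collect_countable_All sets.sets_Collect_imp q sets.sets_Collect_const)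
    finally show "{\<kappa> \<in> space ?Q. K \<kappa> \<le> y} \<in> sets ?Q" .
  qed
  with \<C> show ?thesis by (intro that[of ?D]) auto
qed

section \<open>Common limit points\<close>

text \<open>Otherwise every point of \<open>C\<close> has a neighbourhood that the sequence eventually leaves, and
  finitely many of these neighbourhoods cover \<open>C\<close>.\<close>
lemma compactin_cluster_point:
  assumes "compactin X C" "\<And>k::nat. x k \<in> C"
  obtains l where "l \<in> C" "\<And>U. openin X U \<Longrightarrow> l \<in> U \<Longrightarrow> \<exists>\<^sub>F k in sequentially. x k \<in> U"
proof (rule ccontr)
  assume "\<not> thesis"
  then have "\<forall>l\<in>C. \<exists>U. openin X U \<and> l \<in> U \<and> \<not> (\<exists>\<^sub>F k in sequentially. x k \<in> U)"
    using that by blast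
  then obtain U where U: "\<And>l. l \<in> C \<Longrightarrow> openin X (U l) \<and> l \<in> U l \<and> (\<forall>\<^sub>F k in sequentially. x k \<notin> U l)"
    unfolding not_frequently by metis
  obtain T where T: "finite T" "T \<subseteq> C" "C \<subseteq> (\<Union>l\<in>T. U l)"
    by (rule compactin_finite_subcover[OF assms(1), of U]) (use U in auto)
  have "\<forall>\<^sub>F k in sequentially. \<forall>l\<in>T. x k \<notin> U l"
    using T U by (intro eventually_ball_finite) auto
  then obtain k where "\<forall>l\<in>T. x k \<notin> U l" by (auto simp: eventually_sequentially)
  then show False using T(3) assms(2)[of k] by blast
qed

text \<open>A countable \<open>\<pi>\<close>-system generates the sigma-algebra, and on it a sequence from \<open>\<Theta>\<close> converging to
  \<open>\<nu>\<close> can be chosen directly. If convergence failed for another set \<open>B\<close>, some subsequence would stay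
  away from \<open>\<nu> B\<close>. By compactness it has a cluster point \<open>\<eta>\<close>; as \<open>\<eta>\<close> agrees with \<open>\<nu>\<close> on the
  \<open>\<pi>\<close>-system, also \<open>\<eta> B = \<nu> B\<close>, a contradiction. Thus compactness replaces the metrisability of the
  \<open>\<tau>\<close>-topology, which fails in general.\<close>
lemma closure_point_sequential_limit:
  fixes \<Theta> :: "'a::t2_space measure set"
  assumes \<Theta>: "\<Theta> \<subseteq> finite_measures" and comp: "tau_relatively_compact \<Theta>"
    and \<nu>: "\<nu> \<in> tau_topology closure_of \<Theta>"
    and \<C>: "countable \<C>" "\<C> \<subseteq> sets borel"
  obtains \<mu> where "\<And>k::nat. \<mu> k \<in> \<Theta>"
    "\<And>B. B \<in> sets (sigma UNIV \<C>) \<Longrightarrow> (\<lambda>k. measure (\<mu> k) B) \<longlonglongrightarrow> measure \<nu> B"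
proof -
  let ?C = "tau_topology closure_of \<Theta>"
  have Cfin: "?C \<subseteq> finite_measures" using closure_of_subset_topspace[of tau_topology \<Theta>] by (simp add: topspace_tau_topology)
  have \<Theta>C: "\<Theta> \<subseteq> ?C" using \<Theta> by (auto intro!: closure_of_subset simp: topspace_tau_topology)
  define \<P> where "\<P> = Inter ` {F. finite F \<and> F \<subseteq> \<C>}"
  have \<P>: "countable \<P>" unfolding \<P>_def using countable_Collect_finite_subset[OF \<C>(1)] by auto
  have top: "UNIV \<in> \<P>" unfolding \<P>_def by (rule image_eqI[of _ _ "{}"]) auto
  have \<P>\<C>: "\<P> \<subseteq> sigma_sets UNIV \<C>"
  proof
    fix B assume "B \<in> \<P>"
    then obtain F where F: "B = \<Inter>F" "finite F" "F \<subseteq> \<C>" by (auto simp: \<P>_def)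
    have "(\<Inter>F) \<in> sets (sigma UNIV \<C>)" if "F \<noteq> {}" 
      using that F sets.finite_INT[of F "\<lambda>x. x" "sigma UNIV \<C>"] by auto
    then show "B \<in> sigma_sets UNIV \<C>" using F sigma_sets_top[of UNIV \<C>] by (cases "F = {}") auto
  qed
  have gen: "sigma_sets UNIV \<P> = sigma_sets UNIV \<C>"
  proof (rule sigma_sets_eqI)
    show "B \<in> sigma_sets UNIV \<P>" if "B \<in> \<C>" for B
      using that by (intro sigma_sets.Basic) (auto simp: \<P>_def intro!: image_eqI[of _ _ "{B}"])
  qed (use \<P>\<C> in auto)
  have borel: "sigma_sets UNIV \<C> \<subseteq> sets borel" using \<C>(2) sets.sigma_sets_subset[of \<C> "borel :: 'a measure"] by simp
  define A where "A = from_nat_into \<P>"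
  have A: "range A = \<P>" unfolding A_def using top by (intro range_from_nat_into \<P>) auto
  have Ab: "A j \<in> sets borel" for j using A \<P>\<C> borel by blast
  have "\<exists>\<mu>. \<mu> \<in> \<Theta> \<and> (\<forall>j\<le>k. \<bar>measure \<mu> (A j) - measure \<nu> (A j)\<bar> < 1 / Suc k)" for k
  proof -
    let ?U = "tau_nbhd \<nu> (A ` {..k}) (1 / Suc k)"
    have "openin tau_topology ?U" using Ab by (intro openin_tau_nbhd) auto
    moreover have "\<nu> \<in> ?U" using \<nu> Cfin by (auto simp: tau_nbhd_def)
    ultimately obtain \<mu> where "\<mu> \<in> \<Theta>" "\<mu> \<in> ?U" using \<nu> by (auto simp: in_closure_of)
    then show ?thesis by (auto simp: tau_nbhd_def)
  qed
  then obtain \<mu> where \<mu>: "\<And>k. \<mu> k \<in> \<Theta>" "\<And>k j. j \<le> k \<Longrightarrow> \<bar>measure (\<mu> k) (A j) - measure \<nu> (A j)\<bar> < 1 / Suc k"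
    by metis
  have limA: "(\<lambda>k. measure (\<mu> k) (A j)) \<longlonglongrightarrow> measure \<nu> (A j)" for j
  proof (rule LIM_zero_cancel, rule Lim_null_comparison)
    show "\<forall>\<^sub>F k in sequentially. norm (measure (\<mu> k) (A j) - measure \<nu> (A j)) \<le> 1 / Suc k"
      using \<mu>(2) by (intro eventually_sequentiallyI[of j]) (auto intro: less_imp_le)
    show "(\<lambda>k. 1 / real (Suc k)) \<longlonglongrightarrow> 0" by (rule LIMSEQ_Suc[OF lim_1_over_n])
  qed
  have uniq: "measure \<eta> B = measure \<nu> B"
    if \<eta>: "\<eta> \<in> ?C" and eq: "\<And>j. measure \<eta> (A j) = measure \<nu> (A j)" and B: "B \<in> sigma_sets UNIV \<C>" for \<eta> B
  proof -
    let ?N = "sigma UNIV \<C>"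
    have fin: "finite_measure \<eta>" "finite_measure \<nu>" "sets \<eta> = sets borel" "sets \<nu> = sets borel"
      using \<eta> \<nu> Cfin by (auto simp: finite_measures_def)
    have sp: "space \<eta> = UNIV" "space \<nu> = UNIV" using fin(3,4)[THEN sets_eq_imp_space_eq] by auto
    have r: "emeasure (distr \<rho> ?N (\<lambda>x. x)) X = ennreal (measure \<rho> X)"
      if "\<rho> = \<eta> \<or> \<rho> = \<nu>" "X \<in> sigma_sets UNIV \<C>" for \<rho> X
      using that fin sp borel by (subst emeasure_distr_subalgebra) (auto simp: finite_measure.emeasure_eq_measure)
    have "distr \<eta> ?N (\<lambda>x. x) = distr \<nu> ?N (\<lambda>x. x)"
    proof (rule measure_eqI_generator_eq[where \<Omega>=UNIV and E=\<P> and A="\<lambda>_. UNIV"])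
      show "Int_stable \<P>"
      proof (rule Int_stableI)
        fix a b assume "a \<in> \<P>" "b \<in> \<P>"
        then obtain F G where "a = \<Inter>F" "b = \<Inter>G" "finite F" "finite G" "F \<subseteq> \<C>" "G \<subseteq> \<C>" by (auto simp: \<P>_def)
        then show "a \<inter> b \<in> \<P>" unfolding \<P>_def by (intro image_eqI[of _ _ "F \<union> G"]) auto
      qed
      show "emeasure (distr \<eta> ?N (\<lambda>x. x)) X = emeasure (distr \<nu> ?N (\<lambda>x. x)) X" if X: "X \<in> \<P>" for X
      proof -
        obtain j where "X = A j" using X A by auto
        then show ?thesis using eq r X \<P>\<C> by auto
      qed
      show "emeasure (distr \<eta> ?N (\<lambda>x. x)) UNIV \<noteq> \<infinity>" using r[of \<eta> UNIV] sigma_sets_top[of UNIV \<C>] by simp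
    qed (use gen top in auto)
    then show ?thesis using r[of \<eta> B] r[of \<nu> B] B by simp
  qed
  have "(\<lambda>k. measure (\<mu> k) B) \<longlonglongrightarrow> measure \<nu> B" if B: "B \<in> sets (sigma UNIV \<C>)" for B
  proof (rule ccontr)
    assume "\<not> ?thesis"
    then obtain e where e: "0 < e" "\<exists>\<^sub>F k in sequentially. e \<le> \<bar>measure (\<mu> k) B - measure \<nu> B\<bar>"
      unfolding tendsto_iff not_all not_imp not_eventually by (auto simp: dist_real_def not_less)
    have Bs: "B \<in> sigma_sets UNIV \<C>" using B by simp
    then have Bb: "B \<in> sets borel" using borel by auto
    obtain s :: "nat \<Rightarrow> nat" where s: "strict_mono s" "\<And>k. e \<le> \<bar>measure (\<mu> (s k)) B - measure \<nu> B\<bar>"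
    proof -
      have "infinite {k. e \<le> \<bar>measure (\<mu> k) B - measure \<nu> B\<bar>}"
        using e(2) by (auto simp: frequently_sequentially infinite_nat_iff_unbounded_le)
      from infinite_enumerate[OF this] show ?thesis using that by blast
    qed
    obtain \<eta> where \<eta>: "\<eta> \<in> ?C" "\<And>U. openin tau_topology U \<Longrightarrow> \<eta> \<in> U \<Longrightarrow> \<exists>\<^sub>F k in sequentially. \<mu> (s k) \<in> U"
      using comp \<mu>(1) \<Theta>C unfolding tau_relatively_compact_def
      by (elim compactin_cluster_point[of _ _ "\<lambda>k. \<mu> (s k)"]) auto
    have near: "\<exists>\<^sub>F k in sequentially. \<bar>measure (\<mu> (s k)) D - measure \<eta> D\<bar> < d" if "D \<in> sets borel" "0 < d" for D d
    proof (rule frequently_elim1[OF \<eta>(2)])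
      show "openin tau_topology (tau_nbhd \<eta> {D} d)" using that by (intro openin_tau_nbhd) auto
      show "\<eta> \<in> tau_nbhd \<eta> {D} d" using \<eta>(1) Cfin that by (auto simp: tau_nbhd_def)
    qed (auto simp: tau_nbhd_def)
    have "measure \<eta> (A j) = measure \<nu> (A j)" for j
    proof (rule ccontr)
      assume ne: "measure \<eta> (A j) \<noteq> measure \<nu> (A j)"
      define d where "d = \<bar>measure \<eta> (A j) - measure \<nu> (A j)\<bar> / 2"
      have d: "0 < d" using ne by (simp add: d_def)
      have "(\<lambda>k. measure (\<mu> (s k)) (A j)) \<longlonglongrightarrow> measure \<nu> (A j)"
        using LIMSEQ_subseq_LIMSEQ[OF limA s(1)] by (simp add: comp_def)
      then have "\<forall>\<^sub>F k in sequentially. \<bar>measure (\<mu> (s k)) (A j) - measure \<nu> (A j)\<bar> < d"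
        using d by (auto simp: tendsto_iff dist_real_def)
      then obtain k where "\<bar>measure (\<mu> (s k)) (A j) - measure \<eta> (A j)\<bar> < d" "\<bar>measure (\<mu> (s k)) (A j) - measure \<nu> (A j)\<bar> < d"
        using frequently_ex[OF frequently_eventually_frequently[OF near[OF Ab d]]] by blast
      moreover have "\<bar>measure \<eta> (A j) - measure \<nu> (A j)\<bar> \<le>
          \<bar>measure (\<mu> (s k)) (A j) - measure \<eta> (A j)\<bar> + \<bar>measure (\<mu> (s k)) (A j) - measure \<nu> (A j)\<bar>"
        using dist_triangle3[of "measure \<eta> (A j)" "measure \<nu> (A j)" "measure (\<mu> (s k)) (A j)"] 
        by (simp add: dist_real_def)
      ultimately show False unfolding d_def by argo
    qed
    then have "measure \<eta> B = measure \<nu> B" by (rule uniq[OF \<eta>(1) _ Bs])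
    moreover obtain k where "\<bar>measure (\<mu> (s k)) B - measure \<eta> B\<bar> < e"
      using frequently_ex[OF near[OF Bb e(1)]] by blast
    ultimately show False using s(2)[of k] by simp
  qed
  with \<mu>(1) show ?thesis by (rule that)
qed

text \<open>Along sequences from the two hypotheses with the common limit \<open>\<nu>\<close>, the two error probabilities
  tend to \<open>E\<^sub>\<nu> K\<close> and \<open>1 - E\<^sub>\<nu> K\<close>.\<close>
lemma indistinguishable_of_common_limit:
  fixes \<Theta>0 \<Theta>1 :: "'a::t2_space measure set"
  assumes \<Theta>: "\<Theta>0 \<subseteq> finite_measures" "\<Theta>1 \<subseteq> finite_measures"
    and comp: "tau_relatively_compact \<Theta>0" "tau_relatively_compact \<Theta>1"
    and \<nu>: "\<nu> \<in> tau_topology closure_of \<Theta>0" "\<nu> \<in> tau_topology closure_of \<Theta>1"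
  shows "indistinguishable \<Theta>0 \<Theta>1"
  unfolding indistinguishable_def
proof (intro allI impI)
  fix n :: nat and K :: "(nat \<Rightarrow> 'a measure) \<Rightarrow> real"
  assume K: "is_test n K"
  then obtain \<C> where \<C>: "countable \<C>" "\<C> \<subseteq> sets borel"
    "K \<in> borel_measurable (PiM {1..n} (\<lambda>_. config_space_on (sigma UNIV \<C>)))"
    unfolding is_test_def by (auto elim: statistic_countably_determined)
  have \<nu>f: "\<nu> \<in> finite_measures" using \<nu>(1) closure_of_subset_topspace[of tau_topology \<Theta>0] by (auto simp: topspace_tau_topology)
  obtain \<mu> where \<mu>: "\<And>k. \<mu> k \<in> \<Theta>0" "\<And>B. B \<in> sets (sigma UNIV \<C>) \<Longrightarrow> (\<lambda>k. measure (\<mu> k) B) \<longlonglongrightarrow> measure \<nu> B"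
    using closure_point_sequential_limit[OF \<Theta>(1) comp(1) \<nu>(1) \<C>(1,2)] by blast
  obtain \<rho> where \<rho>: "\<And>k. \<rho> k \<in> \<Theta>1" "\<And>B. B \<in> sets (sigma UNIV \<C>) \<Longrightarrow> (\<lambda>k. measure (\<rho> k) B) \<longlonglongrightarrow> measure \<nu> B"
    using closure_point_sequential_limit[OF \<Theta>(2) comp(2) \<nu>(2) \<C>(1,2)] by blast
  have N: "sets (sigma UNIV \<C>) \<subseteq> sets borel" "space (sigma UNIV \<C>) = UNIV"
    using \<C>(2) sets.sigma_sets_subset[of \<C> "borel :: 'a measure"] by auto
  have l0: "(\<lambda>k. expectation_under n (\<mu> k) K) \<longlonglongrightarrow> expectation_under n \<nu> K"
    by (rule expectation_under_tendsto[OF N _ \<nu>f \<mu>(2) K \<C>(3)]) (use \<mu>(1) \<Theta> in auto)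
  have l1: "(\<lambda>k. expectation_under n (\<rho> k) K) \<longlonglongrightarrow> expectation_under n \<nu> K"
    by (rule expectation_under_tendsto[OF N _ \<nu>f \<rho>(2) K \<C>(3)]) (use \<rho>(1) \<Theta> in auto)
  have l1': "(\<lambda>k. expectation_under n (\<rho> k) (\<lambda>\<kappa>. 1 - K \<kappa>)) \<longlonglongrightarrow> 1 - expectation_under n \<nu> K"
    using tendsto_diff[OF tendsto_const[of 1] l1] \<rho>(1) \<Theta>(2) by (simp add: expectation_under_compl[OF K] subset_iff)
  have one: "ennreal (expectation_under n \<nu> K) + ennreal (1 - expectation_under n \<nu> K) = 1"
  proof -
    have "0 \<le> expectation_under n \<nu> K" "0 \<le> expectation_under n \<nu> (\<lambda>\<kappa>. 1 - K \<kappa>)"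
      unfolding expectation_under_def using is_test_bounds[OF K \<nu>f] by (auto intro!: integral_nonneg_AE AE_I2)
    then show ?thesis by (simp add: expectation_under_compl[OF K \<nu>f] ennreal_plus[symmetric] del: ennreal_plus)
  qed
  have "(\<lambda>k. ennreal (expectation_under n (\<mu> k) K) + ennreal (expectation_under n (\<rho> k) (\<lambda>\<kappa>. 1 - K \<kappa>))) \<longlonglongrightarrow>
     ennreal (expectation_under n \<nu> K) + ennreal (1 - expectation_under n \<nu> K)"
    by (intro tendsto_add tendsto_ennrealI l0 l1')
  then have sum_lim: "(\<lambda>k. ennreal (expectation_under n (\<mu> k) K) + ennreal (expectation_under n (\<rho> k) (\<lambda>\<kappa>. 1 - K \<kappa>))) \<longlonglongrightarrow> 1"
    unfolding one .
  have "ennreal (expectation_under n (\<mu> k) K) + ennreal (expectation_under n (\<rho> k) (\<lambda>\<kappa>. 1 - K \<kappa>)) \<le>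
    alpha_error \<Theta>0 n K + beta_error \<Theta>1 n K" for k
    unfolding alpha_error_def beta_error_def using \<mu>(1) \<rho>(1) by (intro add_mono SUP_upper)
  then show "1 \<le> alpha_error \<Theta>0 n K + beta_error \<Theta>1 n K"
    by (intro LIMSEQ_le_const2[OF sum_lim] exI[of _ 0]) simp
qed

theorem theorem2p9:
  fixes \<Theta>0 \<Theta>1 :: "'a::t2_space measure set"
  assumes "\<Theta>0 \<subseteq> finite_measures" and "\<Theta>1 \<subseteq> finite_measures"
  shows
    "(tau_relatively_compact \<Theta>0 \<and> tau_relatively_compact \<Theta>1 \<and>
        (tau_topology closure_of \<Theta>0) \<inter> (tau_topology closure_of \<Theta>1) \<noteq> {}
      \<longrightarrow> indistinguishable \<Theta>0 \<Theta>1)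
     \<and>
     ((tau_relatively_compact \<Theta>0 \<or> tau_relatively_compact \<Theta>1) \<and>
        (tau_topology closure_of \<Theta>0) \<inter> (tau_topology closure_of \<Theta>1) = {}
      \<longrightarrow> distinguishable \<Theta>0 \<Theta>1 \<and>
          (\<exists>(K :: nat \<Rightarrow> (nat \<Rightarrow> 'a measure) \<Rightarrow> real) (c::real) (n0::nat).
             (\<forall>n\<ge>1. is_test n (K n)) \<and> c > 0 \<and>
             (\<forall>n>n0. alpha_error \<Theta>0 n (K n) \<le> ennreal (exp (- c * real n)) \<and>
                     beta_error \<Theta>1 n (K n) \<le> ennreal (exp (- c * real n)))))"
proof (intro conjI[where P="_ \<longrightarrow> _"] impI)
  assume "tau_relatively_compact \<Theta>0 \<and> tau_relatively_compact \<Theta>1 \<and>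
    (tau_topology closure_of \<Theta>0) \<inter> (tau_topology closure_of \<Theta>1) \<noteq> {}"
  then show "indistinguishable \<Theta>0 \<Theta>1"
    using indistinguishable_of_common_limit[OF assms] by blast
next
  assume h: "(tau_relatively_compact \<Theta>0 \<or> tau_relatively_compact \<Theta>1) \<and>
    (tau_topology closure_of \<Theta>0) \<inter> (tau_topology closure_of \<Theta>1) = {}"
  have "exp_separable \<Theta>0 \<Theta>1"
    using h
  proof (elim conjE disjE)
    assume "tau_relatively_compact \<Theta>1" "(tau_topology closure_of \<Theta>0) \<inter> (tau_topology closure_of \<Theta>1) = {}"
    then show ?thesis
      using assms by (intro exp_separable_sym[OF exp_separable_of_compact]) (auto simp: Int_commute)
  qed (use assms in \<open>auto intro: exp_separable_of_compact\<close>)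
  then show "distinguishable \<Theta>0 \<Theta>1 \<and>
          (\<exists>(K :: nat \<Rightarrow> (nat \<Rightarrow> 'a measure) \<Rightarrow> real) (c::real) (n0::nat).
             (\<forall>n\<ge>1. is_test n (K n)) \<and> c > 0 \<and>
             (\<forall>n>n0. alpha_error \<Theta>0 n (K n) \<le> ennreal (exp (- c * real n)) \<and>
                     beta_error \<Theta>1 n (K n) \<le> ennreal (exp (- c * real n))))"
    using exp_separable_imp_distinguishable unfolding exp_separable_def by blast
qed

end
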